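(* Let $\mathcal{S}$ be a compact convex subset of a Euclidean space with $\mathrm{Aff}(\mathcal{S}) = \mathbb{R}^3$. Then the following two conditions are equivalent: (1) The set $\mathcal{S}$ is affine isomorphic to either a tetrahedron (i.e. a $3$-simplex) or the ($3$-dimensional) unit ball. (2) The group of bijective affine transformations of $\mathcal{S}$ (onto itself) acts transitively on the set $\mathcal{S}_{\mathrm{ext}}$ of extreme points of $\mathcal{S}$, and $\mathcal{S}$ has spectrality.
   Context: $\mathrm{Aff}(\mathcal{S})$ denotes the affine hull of $\mathcal{S}$. A group $G$ acts transitively on a set $X$ if for any $x_1,x_2\in X$ there is $g\in G$ with $g\cdot x_1=x_2$. Two convex sets are affine isomorphic if there is an affine bijection between them. The unit ball is the closed solid ball. Points $s_1,\dots,s_n$ of a convex subset $\mathcal{S}$ of a real vector space are distinguishable if there exist $n$ affine functionals $e_i:\mathcal{S}\to\mathbb{R}$ ($1\le i\le n$) such that $e_i\ge 0$ on $\mathcal{S}$, $\sum_{i=1}^n e_i = 1$ (constantly on $\mathcal{S}$) and $e_i(s_i)=1$ for every $1\le i\le n$. A convex set $\mathcal{S}$ has spectrality if each $s\in\mathcal{S}$ admits a decomposition $s=\sum_{j=1}^{\ell}\lambda_j s_j$ ($1\le \ell<\infty$) into distinguishable extreme points $s_1,\dots,s_\ell\in\mathcal{S}_{\mathrm{ext}}$ such that $\sum_{j=1}^{\ell}\lambda_j=1$ and $\lambda_j\ge 0$ for every $j$. *)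

theory Defs
  imports "HOL-Analysis.Analysis" "HOL-Algebra.Group_Action"
begin

definition affine_map_on :: "'a::real_vector set \<Rightarrow> ('a \<Rightarrow> 'b::real_vector) \<Rightarrow> bool" where
  "affine_map_on S f \<longleftrightarrow>
     (\<forall>x\<in>S. \<forall>y\<in>S. \<forall>t\<in>{0..1}. f ((1 - t) *\<^sub>R x + t *\<^sub>R y) = (1 - t) *\<^sub>R f x + t *\<^sub>R f y)"

definition affine_isomorphic :: "'a::real_vector set \<Rightarrow> 'b::real_vector set \<Rightarrow> bool" where
  "affine_isomorphic S T \<longleftrightarrow> (\<exists>f. affine_map_on S f \<and> bij_betw f S T)"

definition distinguishable :: "'a::real_vector set \<Rightarrow> nat \<Rightarrow> (nat \<Rightarrow> 'a) \<Rightarrow> bool" where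
  "distinguishable S n s \<longleftrightarrow>
     (\<forall>i\<in>{1..n}. s i \<in> S) \<and>
     (\<exists>e :: nat \<Rightarrow> 'a \<Rightarrow> real.
        (\<forall>i\<in>{1..n}. affine_map_on S (e i)) \<and>
        (\<forall>i\<in>{1..n}. \<forall>x\<in>S. 0 \<le> e i x) \<and>
        (\<forall>x\<in>S. (\<Sum>i=1..n. e i x) = 1) \<and>
        (\<forall>i\<in>{1..n}. e i (s i) = 1))"

definition has_spectrality :: "'a::real_vector set \<Rightarrow> bool" where
  "has_spectrality S \<longleftrightarrow>
     (\<forall>x\<in>S. \<exists>l\<ge>1. \<exists>s c.
        (\<forall>j\<in>{1..l}. s j extreme_point_of S) \<and>
        distinguishable S l s \<and>
        (\<forall>j\<in>{1..l}. 0 \<le> c j) \<and>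
        (\<Sum>j=1..l. c j) = 1 \<and>
        x = (\<Sum>j=1..l. c j *\<^sub>R s j))"

text \<open>As in \<^const>\<open>BijGroup\<close>, the elements are extensional functions, so that each bijective affine
  transformation of \<open>S\<close> onto itself is represented exactly once.\<close>

definition affine_automorphism_group :: "'a::real_vector set \<Rightarrow> ('a \<Rightarrow> 'a) monoid" where
  "affine_automorphism_group S = (BijGroup S)\<lparr>carrier := {f \<in> Bij S. affine_map_on S f}\<rparr>"

text \<open>Restriction to the extreme points is the natural action of the group on that set.\<close>

definition affine_automorphisms_transitive_on_extreme_points :: "'a::real_vector set \<Rightarrow> bool" where
  "affine_automorphisms_transitive_on_extreme_points S \<longleftrightarrow>
     transitive_action (affine_automorphism_group S) {x. x extreme_point_of S}
       (\<lambda>g. restrict g {x. x extreme_point_of S})"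

lemma affine_map_onD:
  assumes "affine_map_on S f" "x \<in> S" "y \<in> S" "0 \<le> t" "t \<le> 1"
  shows "f ((1 - t) *\<^sub>R x + t *\<^sub>R y) = (1 - t) *\<^sub>R f x + t *\<^sub>R f y"
  using assms unfolding affine_map_on_def by auto

lemma convex_mem:
  assumes "convex S" "x \<in> S" "y \<in> S" "0 \<le> t" "t \<le> 1"
  shows "(1 - t) *\<^sub>R x + t *\<^sub>R y \<in> S"
  using assms by (simp add: convex_alt)

lemma affine_map_on_cong:
  assumes "convex S" "\<And>x. x \<in> S \<Longrightarrow> f x = g x"
  shows "affine_map_on S f \<longleftrightarrow> affine_map_on S g"
  unfolding affine_map_on_def using assms by (simp add: convex_mem)

lemma affine_map_on_comp:
  assumes f: "affine_map_on S f" and g: "affine_map_on T g" and im: "\<And>x. x \<in> S \<Longrightarrow> f x \<in> T"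
  shows "affine_map_on S (g \<circ> f)"
  using f g im unfolding affine_map_on_def by simp

lemma affine_map_on_inv_into:
  assumes S: "convex S" and f: "affine_map_on S f" and b: "bij_betw f S T"
  shows "affine_map_on T (inv_into S f)"
  unfolding affine_map_on_def
proof (intro ballI)
  fix x y and t :: real
  assume x: "x \<in> T" and y: "y \<in> T" and t: "t \<in> {0..1}"
  let ?h = "inv_into S f"
  let ?z = "(1 - t) *\<^sub>R ?h x + t *\<^sub>R ?h y"
  have hx: "?h x \<in> S" and hy: "?h y \<in> S"
    using x y b by (metis bij_betw_imp_surj_on inv_into_into)+
  have z: "?z \<in> S"
    using convex_mem[OF S hx hy] t by auto
  have "f ?z = (1 - t) *\<^sub>R f (?h x) + t *\<^sub>R f (?h y)"
    using affine_map_onD[OF f hx hy] t by auto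
  also have "\<dots> = (1 - t) *\<^sub>R x + t *\<^sub>R y"
    using x y b by (simp add: bij_betw_inv_into_right)
  finally show "?h ((1 - t) *\<^sub>R x + t *\<^sub>R y) = ?z"
    using z b by (metis bij_betw_inv_into_left)
qed

lemma extreme_point_affine_bij_image:
  assumes S: "convex S" and f: "affine_map_on S f" and b: "bij_betw f S T"
    and x: "x extreme_point_of S"
  shows "f x extreme_point_of T"
proof -
  let ?h = "inv_into S f"
  have xS: "x \<in> S"
    using x by (simp add: extreme_point_of_def)
  have h: "affine_map_on T ?h"
    by (rule affine_map_on_inv_into[OF S f b])
  have "f x \<notin> open_segment a c" if a: "a \<in> T" and c: "c \<in> T" for a c
  proof
    assume "f x \<in> open_segment a c"
    then obtain t where ne: "a \<noteq> c" and t: "0 < t" "t < 1"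
      and fx: "f x = (1 - t) *\<^sub>R a + t *\<^sub>R c"
      by (auto simp: in_segment)
    have "x = ?h (f x)"
      using xS b by (simp add: bij_betw_inv_into_left)
    also have "\<dots> = (1 - t) *\<^sub>R ?h a + t *\<^sub>R ?h c"
      unfolding fx using affine_map_onD[OF h a c] t by simp
    finally have "x = (1 - t) *\<^sub>R ?h a + t *\<^sub>R ?h c" .
    moreover have "?h a \<noteq> ?h c"
      using a c b ne by (metis bij_betw_inv_into_right)
    ultimately have "x \<in> open_segment (?h a) (?h c)"
      using t by (auto simp: in_segment)
    moreover have "?h a \<in> S" "?h c \<in> S"
      using a c b by (metis bij_betw_imp_surj_on inv_into_into)+
    ultimately show False
      using x by (auto simp: extreme_point_of_def)
  qed
  moreover have "f x \<in> T"
    using xS b by (auto dest: bij_betwE)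
  ultimately show ?thesis
    by (simp add: extreme_point_of_def)
qed

lemma subgroup_affine_automorphisms:
  assumes S: "convex S"
  shows "subgroup {f \<in> Bij S. affine_map_on S f} (BijGroup S)"
proof (rule subgroup.intro)
  show "{f \<in> Bij S. affine_map_on S f} \<subseteq> carrier (BijGroup S)"
    by (auto simp: BijGroup_def)
next
  fix f g
  assume f: "f \<in> {f \<in> Bij S. affine_map_on S f}" and g: "g \<in> {f \<in> Bij S. affine_map_on S f}"
  have "affine_map_on S (f \<circ> g)"
    using f g by (intro affine_map_on_comp[where T = S]) (auto dest: Bij_imp_funcset)
  then have "affine_map_on S (compose S f g)"
    using affine_map_on_cong[OF S, of "compose S f g" "f \<circ> g"] by (simp add: compose_eq)
  then show "f \<otimes>\<^bsub>BijGroup S\<^esub> g \<in> {f \<in> Bij S. affine_map_on S f}"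
    using f g by (simp add: BijGroup_def compose_Bij)
next
  have "affine_map_on S (\<lambda>x\<in>S. x) \<longleftrightarrow> affine_map_on S (\<lambda>x. x)"
    by (rule affine_map_on_cong[OF S]) simp
  then show "\<one>\<^bsub>BijGroup S\<^esub> \<in> {f \<in> Bij S. affine_map_on S f}"
    by (simp add: BijGroup_def id_Bij affine_map_on_def)
next
  fix f
  assume f: "f \<in> {f \<in> Bij S. affine_map_on S f}"
  then have "affine_map_on S (inv_into S f)"
    by (intro affine_map_on_inv_into[OF S]) (auto simp: Bij_def)
  then have "affine_map_on S (restrict (inv_into S f) S)"
    using affine_map_on_cong[OF S, of "restrict (inv_into S f) S" "inv_into S f"] by simp
  then show "m_inv (BijGroup S) f \<in> {f \<in> Bij S. affine_map_on S f}"
    using f restrict_inv_into_Bij[of f S] by (simp add: inv_BijGroup)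
qed

lemma group_affine_automorphism_group:
  assumes "convex S"
  shows "group (affine_automorphism_group S)"
  unfolding affine_automorphism_group_def
  by (rule subgroup.subgroup_is_group[OF subgroup_affine_automorphisms[OF assms] group_BijGroup])

lemma affine_automorphism_restrict_extreme_points:
  assumes S: "convex S" and f: "f \<in> Bij S" "affine_map_on S f"
  shows "restrict f {x. x extreme_point_of S} \<in> Bij {x. x extreme_point_of S}"
proof -
  let ?E = "{x. x extreme_point_of S}"
  have b: "bij_betw f S S"
    using f by (simp add: Bij_def)
  have sub: "?E \<subseteq> S"
    by (auto simp: extreme_point_of_def)
  have im: "f ` ?E \<subseteq> ?E"
    using extreme_point_affine_bij_image[OF S f(2) b] by auto
  have "?E \<subseteq> f ` ?E"
  proof
    fix y
    assume y: "y \<in> ?E"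
    have "inv_into S f y extreme_point_of S"
      using y extreme_point_affine_bij_image[OF S affine_map_on_inv_into[OF S f(2) b]
          bij_betw_inv_into[OF b]]
      by simp
    moreover have "y = f (inv_into S f y)"
      using y sub b by (auto simp: bij_betw_inv_into_right)
    ultimately show "y \<in> f ` ?E"
      by blast
  qed
  with im have "f ` ?E = ?E"
    by blast
  moreover have "inj_on f ?E"
    using b sub by (meson bij_betw_imp_inj_on inj_on_subset)
  ultimately have "bij_betw f ?E ?E"
    by (simp add: bij_betw_def)
  then have "bij_betw (restrict f ?E) ?E ?E"
    by (subst bij_betw_cong[where g = f]) auto
  then show ?thesis
    by (simp add: Bij_def)
qed

lemma group_action_affine_automorphisms:
  assumes S: "convex S"
  shows "group_action (affine_automorphism_group S) {x. x extreme_point_of S}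
    (\<lambda>g. restrict g {x. x extreme_point_of S})"
proof -
  let ?E = "{x. x extreme_point_of S}"
  have "(\<lambda>g. restrict g ?E) \<in> hom (affine_automorphism_group S) (BijGroup ?E)"
  proof (rule homI)
    fix f
    assume "f \<in> carrier (affine_automorphism_group S)"
    then show "restrict f ?E \<in> carrier (BijGroup ?E)"
      using affine_automorphism_restrict_extreme_points[OF S, of f]
      by (simp add: affine_automorphism_group_def BijGroup_def)
  next
    fix f g
    assume "f \<in> carrier (affine_automorphism_group S)" "g \<in> carrier (affine_automorphism_group S)"
    then have f: "f \<in> Bij S" "affine_map_on S f" and g: "g \<in> Bij S" "affine_map_on S g"
      by (auto simp: affine_automorphism_group_def)
    have rf: "restrict f ?E \<in> Bij ?E" and rg: "restrict g ?E \<in> Bij ?E"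
      using affine_automorphism_restrict_extreme_points[OF S] f g by auto
    have gE: "g x extreme_point_of S" if "x extreme_point_of S" for x
      using that extreme_point_affine_bij_image[OF S g(2), of S x] g by (simp add: Bij_def)
    have "restrict (compose S f g) ?E = compose ?E (restrict f ?E) (restrict g ?E)"
    proof
      fix x
      show "restrict (compose S f g) ?E x = compose ?E (restrict f ?E) (restrict g ?E) x"
        using gE[of x] by (auto simp: compose_def extreme_point_of_def)
    qed
    then show "restrict (f \<otimes>\<^bsub>affine_automorphism_group S\<^esub> g) ?E =
        restrict f ?E \<otimes>\<^bsub>BijGroup ?E\<^esub> restrict g ?E"
      using f g rf rg by (simp add: affine_automorphism_group_def BijGroup_def)
  qed
  then show ?thesis
    using group_affine_automorphism_group[OF S] group_BijGroup
    by (simp add: group_action_def group_hom_def group_hom_axioms_def)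
qed

lemma affine_automorphisms_transitive_iff:
  assumes S: "convex S"
  shows "affine_automorphisms_transitive_on_extreme_points S \<longleftrightarrow>
    (\<forall>x y. x extreme_point_of S \<longrightarrow> y extreme_point_of S \<longrightarrow>
       (\<exists>f. affine_map_on S f \<and> bij_betw f S S \<and> f x = y))"
    (is "?L \<longleftrightarrow> ?R")
proof
  assume ?L
  then show ?R
    by (fastforce simp: affine_automorphisms_transitive_on_extreme_points_def transitive_action_def
        transitive_action_axioms_def affine_automorphism_group_def Bij_def)
next
  assume R: ?R
  have "\<exists>g\<in>carrier (affine_automorphism_group S). restrict g {x. x extreme_point_of S} x = y"
    if x: "x extreme_point_of S" and y: "y extreme_point_of S" for x y
  proof -
    obtain f where f: "affine_map_on S f" "bij_betw f S S" "f x = y"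
      using R x y by blast
    have "affine_map_on S (restrict f S)"
      using f(1) affine_map_on_cong[OF S, of "restrict f S" f] by simp
    moreover have "bij_betw (restrict f S) S S"
      using f(2) by (subst bij_betw_cong[where g = f]) auto
    moreover have "x \<in> S"
      using x by (simp add: extreme_point_of_def)
    ultimately show ?thesis
      using x f(3)
      by (intro bexI[of _ "restrict f S"]) (auto simp: affine_automorphism_group_def Bij_def)
  qed
  then show ?L
    using group_action_affine_automorphisms[OF S]
    by (simp add: affine_automorphisms_transitive_on_extreme_points_def transitive_action_def
        transitive_action_axioms_def)
qed

end

theory Submission
  imports Defs
begin

text \<open>
  Functionals that distinguish four points of \<open>S\<close> are barycentric coordinates, so \<open>S\<close> is a
  tetrahedron as soon as four extreme points are distinguishable. Otherwise every point is a
  combination of at most three extreme points, and then a dimension count shows that there are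
  infinitely many extreme points. In this case the affine automorphisms of \<open>S\<close> preserve volume,
  hence the centroid and the second moments of \<open>S\<close>, so after an affine change of coordinates they
  are orthogonal and the extreme points lie on one sphere. Being infinite, the group has an
  infinitesimal rotation \<open>x \<mapsto> u \<times> x\<close>, and a maximizer \<open>x\<close> of a linear functional \<open>p\<close> over \<open>S\<close>
  satisfies \<open>p \<bullet> (u \<times> x) = 0\<close>. If some symmetry moves the axis of rotation, this
  makes \<open>x\<close> parallel to \<open>p\<close> for all \<open>p\<close>, and \<open>S\<close> is a ball. If the axis is preserved, the extreme points
  form two full circles at opposite heights, so \<open>S = - S\<close>; then at most two points are distinguishable,
  which is incompatible with spectrality.
\<close>

section \<open>Affine maps on convex sets\<close>

lemma affine_map_on_linear_add:
  assumes "linear L"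
  shows "affine_map_on S (\<lambda>x. L x + k)"
  using assms by (simp add: affine_map_on_def linear_add linear_scale scaleR_add_right)

lemma affine_map_on_diff:
  assumes "affine_map_on S f" "affine_map_on S g"
  shows "affine_map_on S (\<lambda>x. f x - g x)"
  using assms unfolding affine_map_on_def by (simp add: algebra_simps)

text \<open>Applied to the difference of two affine maps, this carries their agreement from a set of
  points over to its convex hull.\<close>

lemma convex_affine_zero_set:
  assumes S: "convex S" and h: "affine_map_on S h"
  shows "convex {x \<in> S. h x = 0}"
  unfolding convex_alt using convex_mem[OF S] affine_map_onD[OF h] by auto

lemma convex_affine_image:
  assumes S: "convex S" and f: "affine_map_on S f"
  shows "convex (f ` S)"
  unfolding convex_alt
proof (intro ballI allI impI)
  fix y z and t :: real
  assume "y \<in> f ` S" "z \<in> f ` S" and t: "0 \<le> t \<and> t \<le> 1"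
  then obtain a b where ab: "a \<in> S" "b \<in> S" "y = f a" "z = f b"
    by blast
  then have "(1 - t) *\<^sub>R y + t *\<^sub>R z = f ((1 - t) *\<^sub>R a + t *\<^sub>R b)"
    using affine_map_onD[OF f] t by simp
  then show "(1 - t) *\<^sub>R y + t *\<^sub>R z \<in> f ` S"
    using convex_mem[OF S ab(1,2)] t by blast
qed

text \<open>The graph of \<open>f\<close> is the image of \<open>S\<close> under the affine map
  \<open>x \<mapsto> (x, f x)\<close>. It is therefore convex and contains the same convex
  combination of the points \<open>(s i, f (s i))\<close>.\<close>

lemma affine_map_on_sum:
  assumes S: "convex S" and f: "affine_map_on S f" and I: "finite I"
    and s: "\<And>i. i \<in> I \<Longrightarrow> s i \<in> S" and c: "\<And>i. i \<in> I \<Longrightarrow> 0 \<le> c i" "sum c I = 1"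
  shows "f (\<Sum>i\<in>I. c i *\<^sub>R s i) = (\<Sum>i\<in>I. c i *\<^sub>R f (s i))"
proof -
  have "affine_map_on S (\<lambda>x. (x, f x))"
    using f unfolding affine_map_on_def by simp
  then have "convex ((\<lambda>x. (x, f x)) ` S)"
    by (rule convex_affine_image[OF S])
  then have "(\<Sum>i\<in>I. c i *\<^sub>R (s i, f (s i))) \<in> (\<lambda>x. (x, f x)) ` S"
    by (intro convex_sum) (use assms in auto)
  then show ?thesis
    by (auto simp: sum_prod)
qed

text \<open>Once a point \<open>a\<close> of \<open>C\<close> is translated to the origin, the
  remaining points are linearly independent, so a linear map can take prescribed values on
  them.\<close>

lemma affine_independent_extend:
  fixes C :: "'a::euclidean_space set" and f :: "'a \<Rightarrow> 'b::real_vector"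
  assumes "\<not> affine_dependent C"
  obtains L k where "linear L" "\<And>x. x \<in> C \<Longrightarrow> f x = L x + k"
proof (cases "C = {}")
  case True
  then show thesis
    using that[of "\<lambda>x. 0" 0] by (simp add: linear_zero)
next
  case False
  then obtain a where a: "a \<in> C"
    by blast
  have "independent ((\<lambda>x. -a + x) ` (C - {a}))"
    using affine_dependent_iff_dependent2[OF a] assms by simp
  from linear_independent_extend[OF this, of "\<lambda>y. f (y + a) - f a"] obtain L where L: "linear L"
    "\<And>y. y \<in> (\<lambda>x. -a + x) ` (C - {a}) \<Longrightarrow> L y = f (y + a) - f a"
    by blast
  have "f x = L x + (f a - L a)" if x: "x \<in> C" for x
  proof (cases "x = a")
    case False
    then have "L (-a + x) = f x - f a"
      using L(2)[of "-a + x"] x by auto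
    moreover have "L (-a + x) = L x - L a"
      using linear_diff[OF L(1), of x a] by simp
    ultimately show ?thesis
      by (metis add.commute add_diff_eq diff_add_cancel diff_diff_eq2)
  qed simp
  then show thesis
    using that L(1) by blast
qed

text \<open>An affine map that vanishes on an affine basis \<open>B \<subseteq> S\<close> vanishes on the simplex
  \<open>convex hull B\<close>; since every point of \<open>S\<close> is joined to an interior point of this simplex by a
  segment, it vanishes on \<open>S\<close>.\<close>

lemma affine_map_on_extend:
  fixes S :: "'a::euclidean_space set" and f :: "'a \<Rightarrow> 'b::real_vector"
  assumes S: "convex S" and hull: "affine hull S = UNIV" and f: "affine_map_on S f"
  obtains L k where "linear L" "\<And>x. x \<in> S \<Longrightarrow> f x = L x + k"
proof -
  obtain B where B: "B \<subseteq> S" "\<not> affine_dependent B" "affine hull B = UNIV"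
    using affine_basis_exists[of S] hull by auto
  obtain L k where L: "linear L" and Lk: "\<And>x. x \<in> B \<Longrightarrow> f x = L x + k"
    using affine_independent_extend[OF B(2)] by metis
  define h where "h x = f x - (L x + k)" for x
  have h: "affine_map_on S h"
    unfolding h_def by (intro affine_map_on_diff f affine_map_on_linear_add L)
  have "convex hull B \<subseteq> {x \<in> S. h x = 0}"
    using B(1) Lk by (intro hull_minimal convex_affine_zero_set S h) (auto simp: h_def)
  then have hull0: "x \<in> S \<and> h x = 0" if "x \<in> convex hull B" for x
    using that by blast
  have "interior (convex hull B) \<noteq> {}"
    using B(3)
    by (metis affine_hull_convex_hull affine_hull_empty convex_convex_hull empty_not_UNIV
        rel_interior_eq_empty rel_interior_interior)
  then obtain z where z: "z \<in> interior (convex hull B)"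
    by blast
  have "h x = 0" if x: "x \<in> S" for x
  proof -
    obtain \<epsilon> where \<epsilon>: "\<epsilon> > 0" "ball z \<epsilon> \<subseteq> convex hull B"
      using z by (auto simp: mem_interior)
    define t where "t = min 1 (\<epsilon> / (2 * (1 + norm (x - z))))"
    have pos: "1 + norm (x - z) > 0"
      by (simp add: add_pos_nonneg)
    have t: "0 < t" "t \<le> 1"
      using \<epsilon>(1) pos by (auto simp: t_def)
    have "t * norm (x - z) \<le> \<epsilon> / (2 * (1 + norm (x - z))) * norm (x - z)"
      by (intro mult_right_mono) (auto simp: t_def)
    also have "\<dots> < \<epsilon>"
      using \<epsilon>(1) pos by (simp add: divide_simps algebra_simps add_pos_nonneg)
    finally have "norm (t *\<^sub>R (x - z)) < \<epsilon>"
      using t by simp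
    moreover have "(1 - t) *\<^sub>R z + t *\<^sub>R x - z = t *\<^sub>R (x - z)"
      by (simp add: algebra_simps)
    ultimately have "(1 - t) *\<^sub>R z + t *\<^sub>R x \<in> ball z \<epsilon>"
      by (metis dist_commute dist_norm mem_ball)
    then have "h ((1 - t) *\<^sub>R z + t *\<^sub>R x) = 0"
      using \<epsilon>(2) hull0 by blast
    moreover have zh: "z \<in> S" "h z = 0"
      using hull0 z interior_subset by blast+
    ultimately show ?thesis
      using affine_map_onD[OF h zh(1) x] t by simp
  qed
  then show thesis
    using that L by (simp add: h_def)
qed

section \<open>Invariance of both conditions under affine bijections\<close>

lemma transitive_on_extreme_points_affine_bij:
  assumes S: "convex S" and f: "affine_map_on S f" and b: "bij_betw f S T"
    and tr: "affine_automorphisms_transitive_on_extreme_points S"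
  shows "affine_automorphisms_transitive_on_extreme_points T"
proof -
  let ?h = "inv_into S f"
  have T: "convex T"
    using convex_affine_image[OF S f] b by (simp add: bij_betw_def)
  note h = affine_map_on_inv_into[OF S f b] bij_betw_inv_into[OF b]
  have "\<exists>g. affine_map_on T g \<and> bij_betw g T T \<and> g x = y"
    if x: "x extreme_point_of T" and y: "y extreme_point_of T" for x y
  proof -
    have "?h x extreme_point_of S" "?h y extreme_point_of S"
      using extreme_point_affine_bij_image[OF T h] x y by auto
    then obtain g where g: "affine_map_on S g" "bij_betw g S S" "g (?h x) = ?h y"
      using tr affine_automorphisms_transitive_iff[OF S] by blast
    have "affine_map_on T (f \<circ> (g \<circ> ?h))"
      using g h by (intro affine_map_on_comp[OF affine_map_on_comp[OF h(1) g(1)] f])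
        (auto simp: bij_betw_apply)
    moreover have "bij_betw (f \<circ> (g \<circ> ?h)) T T"
      using g h b by (meson bij_betw_trans)
    moreover have "f (?h y) = y"
      using y b by (simp add: extreme_point_of_def bij_betw_inv_into_right)
    ultimately show ?thesis
      using g(3) by (intro exI[of _ "f \<circ> (g \<circ> ?h)"]) simp
  qed
  then show ?thesis
    using affine_automorphisms_transitive_iff[OF T] by blast
qed

lemma distinguishable_affine_bij:
  assumes S: "convex S" and f: "affine_map_on S f" and b: "bij_betw f S T"
    and s: "distinguishable S n s"
  shows "distinguishable T n (f \<circ> s)"
proof -
  let ?h = "inv_into S f"
  note h = affine_map_on_inv_into[OF S f b] bij_betw_inv_into[OF b]
  obtain e where sS: "\<And>i. i \<in> {1..n} \<Longrightarrow> s i \<in> S"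
    and e: "\<And>i. i \<in> {1..n} \<Longrightarrow> affine_map_on S (e i)" "\<And>i x. i \<in> {1..n} \<Longrightarrow> x \<in> S \<Longrightarrow> 0 \<le> e i x"
      "\<And>x. x \<in> S \<Longrightarrow> (\<Sum>i=1..n. e i x) = (1::real)" "\<And>i. i \<in> {1..n} \<Longrightarrow> e i (s i) = 1"
    using s unfolding distinguishable_def by blast
  have hS: "?h y \<in> S" if "y \<in> T" for y
    using that h(2) by (rule bij_betw_apply[rotated])
  show ?thesis
    unfolding distinguishable_def
  proof (intro conjI exI[of _ "\<lambda>i. e i \<circ> ?h"] ballI)
    show "affine_map_on T (e i \<circ> ?h)" if "i \<in> {1..n}" for i
      using affine_map_on_comp[OF h(1) e(1)[OF that]] hS by blast
  qed (use sS e hS b in \<open>auto simp: bij_betw_inv_into_left bij_betw_apply\<close>)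
qed

lemma has_spectrality_affine_bij:
  assumes S: "convex S" and f: "affine_map_on S f" and b: "bij_betw f S T"
    and sp: "has_spectrality S"
  shows "has_spectrality T"
  unfolding has_spectrality_def
proof
  fix y
  assume "y \<in> T"
  then obtain x where x: "x \<in> S" "y = f x"
    using b by (auto simp: bij_betw_def)
  then obtain l s c where l: "l \<ge> 1" and s: "\<forall>j\<in>{1..l}. s j extreme_point_of S"
    and d: "distinguishable S l s"
    and c: "\<forall>j\<in>{1..l}. (0::real) \<le> c j" "(\<Sum>j=1..l. c j) = 1" and xs: "x = (\<Sum>j=1..l. c j *\<^sub>R s j)"
    using sp unfolding has_spectrality_def by blast
  have "y = (\<Sum>j=1..l. c j *\<^sub>R (f \<circ> s) j)"
    unfolding x(2) xs using s c
    by (subst affine_map_on_sum[OF S f]) (auto simp: extreme_point_of_def)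
  moreover have "\<forall>j\<in>{1..l}. (f \<circ> s) j extreme_point_of T"
    using s extreme_point_affine_bij_image[OF S f b] by simp
  ultimately show "\<exists>l\<ge>1. \<exists>s c. (\<forall>j\<in>{1..l}. s j extreme_point_of T) \<and> distinguishable T l s \<and>
        (\<forall>j\<in>{1..l}. 0 \<le> c j) \<and> (\<Sum>j=1..l. c j) = 1 \<and> y = (\<Sum>j=1..l. c j *\<^sub>R s j)"
    using l c distinguishable_affine_bij[OF S f b d] by blast
qed

section \<open>Symmetry and spectrality of the unit ball and of simplices\<close>

lemma unit_vector_direction:
  fixes x :: "'a::euclidean_space"
  obtains d where "norm d = 1" "x = norm x *\<^sub>R d"
proof (cases "x = 0")
  case True
  then show thesis
    using that vector_choose_size[of 1] by (metis norm_zero scaleR_zero_left zero_le_one)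
next
  case False
  then show thesis
    using that[of "x /\<^sub>R norm x"] by simp
qed

lemma extreme_point_cball_0_1:
  fixes x :: "'a::euclidean_space"
  shows "x extreme_point_of cball 0 1 \<longleftrightarrow> norm x = 1"
proof
  assume x: "x extreme_point_of cball 0 1"
  then have "norm x \<le> 1"
    by (simp add: extreme_point_of_def)
  moreover have "x \<notin> interior (cball 0 1)"
    using x extreme_point_not_in_interior by blast
  ultimately show "norm x = 1"
    by simp
next
  assume x: "norm x = 1"
  have "x \<notin> open_segment a b" if "norm a \<le> 1" "norm b \<le> 1" for a b
  proof
    assume "x \<in> open_segment a b"
    then have "dist 0 x < max (dist 0 a) (dist 0 b)"
      using dist_decreases_open_segment[of x a b 0] by auto
    then show False
      using x that by auto
  qed
  then show "x extreme_point_of cball 0 1"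
    using x by (auto simp: extreme_point_of_def)
qed

lemma transitive_on_extreme_points_unit_ball:
  "affine_automorphisms_transitive_on_extreme_points (cball (0 :: real ^ 'n) 1)"
  unfolding affine_automorphisms_transitive_iff[OF convex_cball] extreme_point_cball_0_1
proof (intro allI impI)
  fix x y :: "real ^ 'n"
  assume "norm x = 1" "norm y = 1"
  then obtain f where f: "orthogonal_transformation f" "f x = y"
    using orthogonal_transformation_exists by metis
  have "affine_map_on (cball 0 1) f"
    using affine_map_on_linear_add[of f _ 0] f(1) by (simp add: orthogonal_transformation_def)
  moreover have "bij_betw f (cball 0 1) (cball 0 1)"
    using orthogonal_transformation_inj[OF f(1)] image_orthogonal_transformation_cball[OF f(1), of 0 1]
      f(1) linear_0[of f]
    by (auto simp: bij_betw_def orthogonal_transformation_def intro: inj_on_subset)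
  ultimately show "\<exists>f. affine_map_on (cball 0 1) f \<and> bij_betw f (cball 0 1) (cball 0 1) \<and> f x = y"
    using f(2) by blast
qed

text \<open>Every point lies on a diameter, and its endpoints \<open>y\<close> and
  \<open>- y\<close> are distinguished by the functionals \<open>(1 + y \<bullet> z) / 2\<close> and
  \<open>(1 - y \<bullet> z) / 2\<close>.\<close>

lemma has_spectrality_unit_ball:
  "has_spectrality (cball (0 :: 'a::euclidean_space) 1)"
  unfolding has_spectrality_def extreme_point_cball_0_1
proof
  fix x :: 'a
  assume x: "x \<in> cball 0 1"
  obtain y where y: "norm y = 1" "x = norm x *\<^sub>R y"
    by (rule unit_vector_direction)
  define s where "s j = (if j = 1 then y else - y)" for j :: nat
  define c where "c j = (if j = 1 then (1 + norm x) / 2 else (1 - norm x) / 2)" for j :: nat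
  define e where "e j z = (1 + s j \<bullet> z) / 2" for j :: nat and z
  have e_affine: "affine_map_on (cball 0 1) (e j)" for j
    unfolding affine_map_on_def e_def
    by (auto simp: inner_add_right add_divide_distrib simp flip: distrib_left)
      (simp add: algebra_simps add_divide_distrib diff_divide_distrib)
  have ns: "norm (s j) = 1" for j
    using y by (simp add: s_def)
  have "0 \<le> e j z" if "norm z \<le> 1" for j z
  proof -
    have "\<bar>s j \<bullet> z\<bar> \<le> norm (s j) * norm z"
      by (rule Cauchy_Schwarz_ineq2)
    then have "\<bar>s j \<bullet> z\<bar> \<le> 1"
      using that ns[of j] by simp
    then show ?thesis
      unfolding e_def by (simp add: abs_le_iff)
  qed
  moreover have "e j (s j) = 1" for j
    using ns[of j] by (simp add: e_def dot_square_norm)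
  moreover have "(\<Sum>j=1..2. e j z) = 1" for z
    by (simp add: e_def s_def numeral_2_eq_2 field_simps)
  ultimately have "distinguishable (cball 0 1) 2 s"
    using ns e_affine unfolding distinguishable_def by (intro conjI exI[of _ e]) auto
  moreover have "\<forall>j\<in>{1..2}. 0 \<le> c j"
    using x by (simp add: c_def)
  moreover have "(\<Sum>j=1..2. c j) = 1"
    by (simp add: c_def numeral_2_eq_2 field_simps)
  moreover have "x = (\<Sum>j=1..2. c j *\<^sub>R s j)"
  proof -
    have "(\<Sum>j=1..2. c j *\<^sub>R s j) = ((1 + norm x) / 2 - (1 - norm x) / 2) *\<^sub>R y"
      unfolding scaleR_left_diff_distrib by (simp add: c_def s_def numeral_2_eq_2)
    also have "\<dots> = norm x *\<^sub>R y"
      by (simp add: field_simps)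
    finally show ?thesis
      using y(2) by simp
  qed
  ultimately show "\<exists>l\<ge>1. \<exists>s c. (\<forall>j\<in>{1..l}. norm (s j) = 1) \<and> distinguishable (cball 0 1) l s \<and>
        (\<forall>j\<in>{1..l}. 0 \<le> c j) \<and> (\<Sum>j=1..l. c j) = 1 \<and> x = (\<Sum>j=1..l. c j *\<^sub>R s j)"
    using ns by (intro exI[of _ "2::nat"]) auto
qed

text \<open>A transposition of two vertices extends to an affine map \<open>f\<close>. As
  \<open>f \<circ> f\<close> fixes all vertices, it is the identity on the simplex, so
  \<open>f\<close> is its own inverse there.\<close>

lemma transitive_on_extreme_points_simplex:
  fixes C :: "'a::euclidean_space set"
  assumes C: "\<not> affine_dependent C"
  shows "affine_automorphisms_transitive_on_extreme_points (convex hull C)"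
  unfolding affine_automorphisms_transitive_iff[OF convex_convex_hull]
    extreme_point_of_convex_hull_affine_independent[OF C]
proof (intro allI impI)
  fix x y
  assume xy: "x \<in> C" "y \<in> C"
  define \<tau> where "\<tau> = Transposition.transpose x y"
  obtain L k where L: "linear L" and Lk: "\<And>z. z \<in> C \<Longrightarrow> \<tau> z = L z + k"
    using affine_independent_extend[OF C] by metis
  define f where "f z = L z + k" for z
  have f: "affine_map_on A f" for A
    unfolding f_def using L by (rule affine_map_on_linear_add)
  have fC: "f z = \<tau> z" if "z \<in> C" for z
    using Lk that by (simp add: f_def)
  have \<tau>C: "\<tau> ` C = C"
    using xy by (simp add: \<tau>_def transpose_image_eq)
  then have fimC: "f ` C = C"
    using fC by (metis image_cong)
  have im: "f ` (convex hull C) \<subseteq> convex hull C"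
  proof -
    have "f ` (convex hull C) = (\<lambda>z. k + z) ` L ` (convex hull C)"
      by (auto simp: f_def image_image add.commute)
    also have "\<dots> = convex hull ((\<lambda>z. k + z) ` L ` C)"
      using L by (simp add: convex_hull_linear_image convex_hull_translation)
    also have "(\<lambda>z. k + z) ` L ` C = f ` C"
      by (auto simp: f_def image_image add.commute)
    finally show ?thesis
      using fimC by simp
  qed
  have "affine_map_on (convex hull C) (\<lambda>z. (f \<circ> f) z - z)"
    using affine_map_on_comp[OF f f, of "convex hull C"]
    by (intro affine_map_on_diff) (auto simp: affine_map_on_def)
  then have "convex {z \<in> convex hull C. (f \<circ> f) z - z = 0}"
    by (intro convex_affine_zero_set) auto
  moreover have "(f \<circ> f) z - z = 0" if "z \<in> C" for z
  proof -
    have "\<tau> z \<in> C"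
      using that \<tau>C by blast
    then show ?thesis
      using that fC by (simp add: \<tau>_def)
  qed
  ultimately have "convex hull C \<subseteq> {z \<in> convex hull C. (f \<circ> f) z - z = 0}"
    by (intro hull_minimal) (auto simp: hull_inc)
  then have "f (f z) = z" if "z \<in> convex hull C" for z
    using that by auto
  then have "bij_betw f (convex hull C) (convex hull C)"
    using im by (intro bij_betw_byWitness[where f' = f]) auto
  moreover have "f x = y"
    using fC xy by (simp add: \<tau>_def)
  ultimately show "\<exists>f. affine_map_on (convex hull C) f \<and> bij_betw f (convex hull C) (convex hull C) \<and> f x = y"
    using f by blast
qed

text \<open>The barycentric coordinates distinguish all the vertices at once, and they are also the
  weights of the decomposition.\<close>

lemma has_spectrality_simplex:
  fixes C :: "'a::euclidean_space set"
  assumes C: "\<not> affine_dependent C"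
  shows "has_spectrality (convex hull C)"
  unfolding has_spectrality_def extreme_point_of_convex_hull_affine_independent[OF C]
proof
  fix x
  assume x: "x \<in> convex hull C"
  have fin: "finite C"
    using C by (rule aff_independent_finite)
  obtain s where s: "bij_betw s {1..card C} C"
    using ex_bij_betw_nat_finite_1[OF fin] by blast
  obtain u where u: "\<And>y. y \<in> C \<Longrightarrow> 0 \<le> u y" "sum u C = 1" "x = (\<Sum>y\<in>C. u y *\<^sub>R y)"
    using x by (auto simp: convex_hull_finite[OF fin])
  have "\<exists>L k. linear L \<and> (\<forall>y\<in>C. (if y = s j then 1 else 0 :: real) = L y + k)" for j
    using affine_independent_extend[OF C, of "\<lambda>y. if y = s j then 1 else 0 :: real"] by metis
  then obtain L k where L: "\<And>j. linear (L j)"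
    and Lk: "\<And>j y. y \<in> C \<Longrightarrow> (if y = s j then 1 else 0 :: real) = L j y + k j"
    by metis
  define e where "e j y = L j y + k j" for j y
  have e: "affine_map_on A (e j)" for A j
    unfolding e_def using L by (rule affine_map_on_linear_add)
  have sC: "s j \<in> C" if "j \<in> {1..card C}" for j
    using that s by (rule bij_betw_apply[rotated])
  have eC: "e j y = (if y = s j then 1 else 0)" if "y \<in> C" for j y
    unfolding e_def using Lk[OF that] by simp
  have esum: "e j (\<Sum>y\<in>C. v y *\<^sub>R y) = v (s j)"
    if "j \<in> {1..card C}" "\<And>y. y \<in> C \<Longrightarrow> 0 \<le> v y" "sum v C = 1" for j v
    using affine_map_on_sum[OF convex_UNIV e fin, of "\<lambda>y. y" v j] that eC fin sC
    by (simp add: if_distrib cong: if_cong)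
  have "distinguishable (convex hull C) (card C) s"
    unfolding distinguishable_def
  proof (intro conjI exI[of _ e] ballI)
    fix y assume "y \<in> convex hull C"
    then obtain v where v: "\<And>y. y \<in> C \<Longrightarrow> 0 \<le> v y" "sum v C = 1" "y = (\<Sum>y\<in>C. v y *\<^sub>R y)"
      by (auto simp: convex_hull_finite[OF fin])
    then have ey: "e j y = v (s j)" if "j \<in> {1..card C}" for j
      using esum that by simp
    show "0 \<le> e j y" if "j \<in> {1..card C}" for j
      using ey that v(1) sC by simp
    show "(\<Sum>j=1..card C. e j y) = 1"
      using ey v(2) sum.reindex_bij_betw[OF s, of v] by simp
  qed (use e eC sC in \<open>auto simp: hull_inc\<close>)
  moreover have "(\<Sum>j=1..card C. u (s j)) = 1"
    using u(2) sum.reindex_bij_betw[OF s, of u] by simp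
  moreover have "x = (\<Sum>j=1..card C. u (s j) *\<^sub>R s j)"
    using u(3) sum.reindex_bij_betw[OF s, of "\<lambda>y. u y *\<^sub>R y"] by simp
  moreover have "card C \<ge> 1"
    using x fin by (auto simp: Suc_le_eq card_gt_0_iff)
  ultimately show "\<exists>l\<ge>1. \<exists>s c. (\<forall>j\<in>{1..l}. s j \<in> C) \<and> distinguishable (convex hull C) l s \<and>
        (\<forall>j\<in>{1..l}. 0 \<le> c j) \<and> (\<Sum>j=1..l. c j) = 1 \<and> x = (\<Sum>j=1..l. c j *\<^sub>R s j)"
    using sC u(1) by (intro exI[of _ "card C"] conjI exI[of _ s] exI[of _ "\<lambda>j. u (s j)"]) auto
qed

section \<open>Consequences of spectrality: a simplex, or infinitely many extreme points\<close>

text \<open>The functionals that distinguish \<open>DIM('a) + 1\<close> points of \<open>S\<close> are the barycentric coordinates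
  of the simplex spanned by these points; being nonnegative on \<open>S\<close>, they force \<open>S\<close> into this simplex.\<close>

lemma simplex_of_distinguishable:
  fixes S :: "'a::euclidean_space set"
  assumes S: "convex S" "affine hull S = UNIV" and d: "distinguishable S n s"
    and n: "DIM('a) < n"
  shows "int DIM('a) simplex S"
proof -
  obtain e where sS: "\<And>i. i \<in> {1..n} \<Longrightarrow> s i \<in> S"
    and e: "\<And>i. i \<in> {1..n} \<Longrightarrow> affine_map_on S (e i)" "\<And>i x. i \<in> {1..n} \<Longrightarrow> x \<in> S \<Longrightarrow> 0 \<le> e i x"
      "\<And>x. x \<in> S \<Longrightarrow> (\<Sum>i=1..n. e i x) = (1::real)" "\<And>i. i \<in> {1..n} \<Longrightarrow> e i (s i) = 1"
    using d unfolding distinguishable_def by blast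
  have delta: "e i (s j) = (if i = j then 1 else 0)" if ij: "i \<in> {1..n}" "j \<in> {1..n}" for i j
  proof (cases "i = j")
    case False
    \<comment> \<open>At \<open>s j\<close> the \<open>j\<close>-th functional already exhausts the
      total 1, and the others are nonnegative.\<close>
    have "(\<Sum>i\<in>{1..n} - {j}. e i (s j)) = 0"
      using e(3)[OF sS[OF ij(2)]] e(4)[OF ij(2)] ij(2) by (simp add: sum.remove[of _ j])
    then have "e i (s j) = 0"
      using e(2) sS ij False by (subst (asm) sum_nonneg_eq_0_iff) auto
    then show ?thesis
      using False by simp
  qed (use e(4) ij in simp)
  have inj: "inj_on s {1..n}"
    using delta by (metis inj_onI zero_neq_one)
  define C where "C = s ` {1..n}"
  have fin: "finite C" and cardC: "card C = n"
    using inj by (auto simp: C_def card_image)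
  have "\<exists>L k. linear L \<and> (\<forall>x\<in>S. e i x = L x + k)" if "i \<in> {1..n}" for i
    using affine_map_on_extend[OF S e(1)[OF that]] by metis
  then obtain L k where L: "\<And>i. i \<in> {1..n} \<Longrightarrow> linear (L i)"
    and Lk: "\<And>i x. i \<in> {1..n} \<Longrightarrow> x \<in> S \<Longrightarrow> e i x = L i x + k i"
    by metis
  have CS: "C \<subseteq> S"
    using sS by (auto simp: C_def)
  \<comment> \<open>Each functional reads off one coefficient. The factor \<open>sum u C\<close>
    admits weights of any total: total 0 yields affine independence, total 1 yields the coordinates
    of a point.\<close>
  have coord: "L i (\<Sum>y\<in>C. u y *\<^sub>R y) + k i * sum u C = u (s i)" if i: "i \<in> {1..n}" for i u
  proof -
    have "L i (\<Sum>y\<in>C. u y *\<^sub>R y) + k i * sum u C = (\<Sum>y\<in>C. u y * (L i y + k i))"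
      by (simp add: linear_sum[OF L[OF i]] linear_scale[OF L[OF i]] sum_distrib_left
          sum.distrib distrib_left mult.commute)
    also have "\<dots> = (\<Sum>y\<in>C. u y * e i y)"
      using Lk[OF i] CS by (intro sum.cong) auto
    also have "\<dots> = (\<Sum>j\<in>{1..n}. u (s j) * e i (s j))"
      unfolding C_def using inj by (simp add: sum.reindex)
    also have "\<dots> = (\<Sum>j\<in>{1..n}. if j = i then u (s j) else 0)"
      using delta[OF i] by (intro sum.cong) auto
    also have "\<dots> = u (s i)"
      using i by simp
    finally show ?thesis .
  qed
  have indep: "\<not> affine_dependent C"
    unfolding affine_dependent_explicit_finite[OF fin]
  proof
    assume "\<exists>U. sum U C = 0 \<and> (\<exists>v\<in>C. U v \<noteq> 0) \<and> (\<Sum>v\<in>C. U v *\<^sub>R v) = 0"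
    then obtain U i where "sum U C = 0" "i \<in> {1..n}" "U (s i) \<noteq> 0" "(\<Sum>v\<in>C. U v *\<^sub>R v) = 0"
      by (auto simp: C_def)
    then show False
      using coord[of i U] linear_0[OF L] by simp
  qed
  then have "int n \<le> int DIM('a) + 1"
    using aff_dim_affine_independent[OF indep] aff_dim_le_DIM[of C] cardC by simp
  then have n': "n = DIM('a) + 1"
    using n by simp
  then have "affine hull C = UNIV"
    using indep cardC affine_independent_span_gt[of C] by simp
  then have affC: "\<exists>u. sum u C = 1 \<and> (\<Sum>y\<in>C. u y *\<^sub>R y) = x" for x
    using affine_hull_finite[OF fin] by blast
  have "S \<subseteq> convex hull C"
  proof
    fix x assume x: "x \<in> S"
    obtain u where u: "sum u C = 1" "(\<Sum>y\<in>C. u y *\<^sub>R y) = x"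
      using affC by blast
    have "0 \<le> u y" if y: "y \<in> C" for y
    proof -
      obtain i where i: "i \<in> {1..n}" "y = s i"
        using y unfolding C_def by blast
      then show ?thesis
        using coord[of i u] u Lk[OF i(1) x] e(2)[OF i(1) x] by simp
    qed
    then show "x \<in> convex hull C"
      using u by (auto simp: convex_hull_finite[OF fin])
  qed
  moreover have "convex hull C \<subseteq> S"
    using CS S(1) by (rule hull_minimal)
  ultimately have "S = convex hull C"
    by blast
  then show ?thesis
    using indep cardC n' by (auto simp: simplex_def)
qed

text \<open>Otherwise every point of \<open>S\<close> is a combination of at most \<open>DIM('a)\<close> extreme points, so
  finitely many simplices of smaller dimension would cover \<open>S\<close>.\<close>

lemma infinite_extreme_points:
  fixes S :: "'a::euclidean_space set"
  assumes S: "convex S" "affine hull S = UNIV" and sp: "has_spectrality S"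
    and not_simplex: "\<not> int DIM('a) simplex S"
  shows "infinite {x. x extreme_point_of S}"
proof
  let ?E = "{x. x extreme_point_of S}"
  assume fin: "finite ?E"
  let ?F = "{F. F \<subseteq> ?E \<and> card F \<le> DIM('a)}"
  have "S \<subseteq> (\<Union>F\<in>?F. convex hull F)"
  proof
    fix x assume "x \<in> S"
    then obtain l s c where s: "\<forall>j\<in>{1..l}. s j extreme_point_of S"
      and d: "distinguishable S l s"
      and c: "\<forall>j\<in>{1..l}. (0::real) \<le> c j" "(\<Sum>j=1..l. c j) = 1" and xs: "x = (\<Sum>j=1..l. c j *\<^sub>R s j)"
      using sp unfolding has_spectrality_def by blast
    have "l \<le> DIM('a)"
      using simplex_of_distinguishable[OF S d] not_simplex by (meson not_le)
    then have "card (s ` {1..l}) \<le> DIM('a)"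
      using card_image_le[of "{1..l}" s] by simp
    moreover have "x \<in> convex hull (s ` {1..l})"
      unfolding xs using c by (intro convex_sum) (auto simp: hull_inc)
    ultimately show "x \<in> (\<Union>F\<in>?F. convex hull F)"
      using s by (intro UN_I[of "s ` {1..l}"]) auto
  qed
  moreover have "negligible (\<Union>F\<in>?F. convex hull F)"
  proof (intro negligible_Union)
    show "finite ((hull) convex ` ?F)"
      using fin by (intro finite_imageI) (simp add: finite_subset[of _ "Pow ?E"])
    show "negligible T" if T: "T \<in> (hull) convex ` ?F" for T
    proof -
      obtain F where F: "F \<in> ?F" "T = convex hull F"
        using T by blast
      then have "finite F"
        using fin by (auto intro: finite_subset)
      then have "interior T = {}"
        using F empty_interior_convex_hull[of F] by simp
      then show ?thesis
        using F by (simp add: negligible_convex_interior)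
    qed
  qed
  ultimately have "negligible S"
    by (rule negligible_subset[rotated])
  then have "interior S = {}"
    using S(1) by (simp add: negligible_convex_interior)
  \<comment> \<open>A convex set whose affine hull is the whole space has interior points.\<close>
  then show False
    using S by (metis affine_hull_empty empty_not_UNIV rel_interior_eq_empty rel_interior_interior)
qed

section \<open>Integrals over \<open>S\<close> and orthogonal coordinates\<close>

lemma absolutely_integrable_continuous_compact:
  fixes f :: "'a::euclidean_space \<Rightarrow> 'b::euclidean_space"
  assumes "compact S" "continuous_on S f"
  shows "f absolutely_integrable_on S"
  using borel_integrable_compact[OF assms]
  by (simp add: set_integrable_def integrable_completion borel_measurable_integrable)

lemma integral_affine_bij:
  fixes S :: "(real ^ 'n::{finite,wellorder}) set" and \<phi> :: "real ^ 'n::_ \<Rightarrow> real"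
  assumes S: "compact S" and f: "\<And>x. f x = A *v x + k" and b: "bij_betw f S S"
    and \<phi>: "continuous_on S \<phi>"
  shows "\<bar>det A\<bar> * integral S (\<lambda>x. \<phi> (f x)) = integral S \<phi>"
proof -
  \<comment> \<open>The change of variables theorem concerns vector-valued integrands, so real
    values are wrapped in \<open>real ^ 1\<close>.\<close>
  let ?\<psi> = "\<lambda>x. vec (\<phi> x) :: real ^ 1"
  have f': "f = (\<lambda>x. A *v x + k)"
    using f by blast
  have im: "f ` S = S" "inj_on f S"
    using b by (auto simp: bij_betw_def)
  have "\<phi> absolutely_integrable_on S"
    by (rule absolutely_integrable_continuous_compact[OF S \<phi>])
  then have "?\<psi> absolutely_integrable_on f ` S \<and> integral (f ` S) ?\<psi> = vec (integral S \<phi>)"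
    unfolding im absolutely_integrable_on_1_iff integral_on_1_eq by simp
  moreover have "(f has_derivative (\<lambda>x. A *v x)) (at x within S)" for x
    unfolding f' by (auto intro!: derivative_eq_intros linear_imp_has_derivative)
  ultimately have "integral S (\<lambda>x. \<bar>det (matrix ((*v) A))\<bar> *\<^sub>R ?\<psi> (f x)) = vec (integral S \<phi>)"
    using has_absolute_integral_change_of_variables[of S f "\<lambda>x. (*v) A" ?\<psi> "vec (integral S \<phi>)"]
      im(2) lmeasurable_compact[OF S] by (auto simp: fmeasurableD)
  then show ?thesis
    unfolding integral_on_1_eq by (simp add: vec_eq_iff)
qed

text \<open>Otherwise the integral over a box around \<open>x\<close> would vanish, and a continuous
  nonnegative function with zero integral over a box is zero on it. This gives positive volume and a
  positive definite second moment form.\<close>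

lemma integral_positive_somewhere:
  fixes \<phi> :: "'a::euclidean_space \<Rightarrow> real"
  assumes S: "compact S" and \<phi>: "continuous_on S \<phi>" "\<And>x. x \<in> S \<Longrightarrow> 0 \<le> \<phi> x"
    and x: "x \<in> interior S" "\<phi> x \<noteq> 0"
  shows "0 < integral S \<phi>"
proof (rule ccontr)
  assume "\<not> 0 < integral S \<phi>"
  obtain a b where "cbox a b \<subseteq> interior S" and xab: "x \<in> box a b"
    by (rule open_contains_cbox[OF open_interior x(1)])
  then have ab: "x \<in> box a b" "cbox a b \<subseteq> S"
    using interior_subset[of S] by auto
  have int: "\<phi> integrable_on T" if "T = S \<or> T = cbox a b" for T
  proof -
    have "compact T" "continuous_on T \<phi>"
      using that S \<phi>(1) ab(2) continuous_on_subset by auto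
    then show ?thesis
      using absolutely_integrable_continuous_compact set_lebesgue_integral_eq_integral(1) by blast
  qed
  have "integral (cbox a b) \<phi> \<le> integral S \<phi>"
    using ab(2) int \<phi>(2) by (intro integral_subset_le) auto
  moreover have "0 \<le> integral (cbox a b) \<phi>"
    using ab(2) int \<phi>(2) by (intro integral_nonneg) auto
  ultimately have "integral (cbox a b) \<phi> = 0"
    using \<open>\<not> 0 < integral S \<phi>\<close> by linarith
  then have "(\<phi> has_integral 0) (cbox a b)"
    using int by (metis integrable_integral)
  moreover have "x \<in> cbox a b"
    using ab(1) box_subset_cbox by blast
  ultimately have "\<phi> x = 0"
    using ab \<phi> continuous_on_subset[OF \<phi>(1) ab(2)] box_subset_cbox[of a b]
    by (intro has_integral_0_cbox_imp_0[of a b \<phi> x]) auto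
  then show False
    using x(2) by simp
qed

text \<open>The columns of \<open>M\<close> are a \<open>Q\<close>-orthonormal basis
  \<open>e1\<close>, \<open>e2\<close>, \<open>e3\<close>, built by the Gram-Schmidt
  process.\<close>

lemma orthonormal_basis_for_form:
  fixes Q :: "real ^ 3 \<Rightarrow> real ^ 3 \<Rightarrow> real"
  assumes bil: "bilinear Q" and sym: "\<And>a b. Q a b = Q b a" and pos: "\<And>a. a \<noteq> 0 \<Longrightarrow> 0 < Q a a"
  obtains M :: "real ^ 3 ^ 3" where "\<And>a b. Q (M *v a) (M *v b) = a \<bullet> b"
proof -
  note [simp] = bilinear_ladd[OF bil] bilinear_radd[OF bil] bilinear_lmul[OF bil] bilinear_rmul[OF bil]
    bilinear_lsub[OF bil] bilinear_rsub[OF bil] bilinear_lzero[OF bil] bilinear_rzero[OF bil]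
  have normalize: "\<exists>e. Q e e = 1 \<and> (\<forall>b. Q w b = 0 \<longrightarrow> Q e b = 0)" if "w \<noteq> 0" for w
  proof -
    have "Q w w > 0"
      using pos that by blast
    then have "Q ((1 / sqrt (Q w w)) *\<^sub>R w) ((1 / sqrt (Q w w)) *\<^sub>R w) = 1"
      by (simp add: field_simps flip: power2_eq_square)
    then show ?thesis
      by (intro exI[of _ "(1 / sqrt (Q w w)) *\<^sub>R w"]) simp
  qed
  have outside: "\<exists>v. v \<notin> span F" if "finite F" "card F \<le> 2" for F :: "(real ^ 3) set"
  proof -
    have "dim (span F) \<le> 2"
      using dim_le_card[of "span F" F] that by (simp add: order_trans)
    then have "span F \<noteq> UNIV"
      using dim_UNIV[where 'a="real ^ 3"] by fastforce
    then show ?thesis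
      by blast
  qed
  obtain e1 where e1: "Q e1 e1 = 1"
    using normalize[of "axis 1 1"] by (auto simp: axis_eq_0_iff)
  obtain v where v: "v \<notin> span {e1}"
    using outside[of "{e1}"] by auto
  have "v - Q v e1 *\<^sub>R e1 \<noteq> 0"
    using v by (metis eq_iff_diff_eq_0 span_base span_scale insertI1)
  then have "\<exists>e2. Q e2 e2 = 1 \<and> Q e2 e1 = 0"
    using normalize[of "v - Q v e1 *\<^sub>R e1"] e1 by fastforce
  then obtain e2 where e2: "Q e2 e2 = 1" "Q e2 e1 = 0"
    by blast
  obtain w where w: "w \<notin> span {e1, e2}"
    using outside[of "{e1, e2}"] card_insert_le_m1[of 2 "{e2}" e1] by auto
  have "w - (Q w e1 *\<^sub>R e1 + Q w e2 *\<^sub>R e2) \<noteq> 0"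
    using w by (metis eq_iff_diff_eq_0 span_base span_scale span_add insertI1 insertI2)
  moreover have "Q (w - (Q w e1 *\<^sub>R e1 + Q w e2 *\<^sub>R e2)) e1 = 0" "Q (w - (Q w e1 *\<^sub>R e1 + Q w e2 *\<^sub>R e2)) e2 = 0"
    using e1 e2 sym[of e1 e2] by auto
  ultimately obtain e3 where e3: "Q e3 e3 = 1" "Q e3 e1 = 0" "Q e3 e2 = 0"
    using normalize by metis
  have "linear (\<lambda>a::real^3. a$1 *\<^sub>R e1 + a$2 *\<^sub>R e2 + a$3 *\<^sub>R e3)"
    by (intro linearI) (auto simp: algebra_simps)
  then have "matrix (\<lambda>a. a$1 *\<^sub>R e1 + a$2 *\<^sub>R e2 + a$3 *\<^sub>R e3) *v a =
      a$1 *\<^sub>R e1 + a$2 *\<^sub>R e2 + a$3 *\<^sub>R e3" for a :: "real ^ 3"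
    by (simp add: matrix_works)
  then show thesis
    using e1 e2 e3 sym[of e1 e2] sym[of e1 e3] sym[of e2 e3]
    by (intro that[of "matrix (\<lambda>a. a$1 *\<^sub>R e1 + a$2 *\<^sub>R e2 + a$3 *\<^sub>R e3)"])
      (simp add: inner_vec_def sum_3)
qed

text \<open>The affine automorphisms of \<open>S\<close> preserve Lebesgue measure, hence fix the centroid \<open>c\<close> of \<open>S\<close>
  and preserve the form \<open>Q a b = \<integral>\<^sub>S (a \<bullet> (x - c)) (b \<bullet> (x - c)) dx\<close>; in coordinates that are
  orthonormal for the dual of \<open>Q\<close> they are orthogonal.\<close>

lemma affine_automorphisms_orthogonal:
  fixes S :: "(real ^ 3) set"
  assumes S: "compact S" "convex S" "affine hull S = UNIV"
  obtains L :: "real ^ 3 ^ 3" and c where "invertible L"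
    "\<And>f. affine_map_on S f \<Longrightarrow> bij_betw f S S \<Longrightarrow>
      \<exists>A. orthogonal_matrix A \<and> (\<forall>x\<in>S. L *v (f x - c) = A *v (L *v (x - c)))"
proof -
  have int: "\<phi> integrable_on S" if "continuous_on S \<phi>" for \<phi> :: "real ^ 3 \<Rightarrow> 'b::euclidean_space"
    using absolutely_integrable_continuous_compact[OF S(1) that] set_lebesgue_integral_eq_integral(1)
    by blast
  have intS: "interior S \<noteq> {}"
    using S by (metis affine_hull_empty empty_not_UNIV rel_interior_eq_empty rel_interior_interior)
  define V where "V = integral S (\<lambda>x. 1 :: real)"
  have V: "V > 0"
    using intS integral_positive_somewhere[OF S(1), of "\<lambda>x. 1"] by (auto simp: V_def)
  define c where "c = (1 / V) *\<^sub>R integral S (\<lambda>x. x)"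
  have c: "integral S (\<lambda>x. a \<bullet> x) = V * (a \<bullet> c)" for a
  proof -
    have "integral S (\<lambda>x. a \<bullet> x) = a \<bullet> integral S (\<lambda>x. x)"
      using integral_linear[OF int bounded_linear_inner_right[of a], of "\<lambda>x. x"]
      by (simp add: o_def continuous_on_id)
    then show ?thesis
      using V by (simp add: c_def)
  qed
  define Q where "Q a b = integral S (\<lambda>x. (a \<bullet> (x - c)) * (b \<bullet> (x - c)))" for a b
  have Qint: "(\<lambda>x. (a \<bullet> (x - c)) * (b \<bullet> (x - c))) integrable_on S" for a b
    by (intro int continuous_intros)
  have lin: "linear (\<lambda>b. Q a b)" for a
    unfolding Q_def
  proof (intro linearI)
    fix b b'
    show "integral S (\<lambda>x. (a \<bullet> (x - c)) * ((b + b') \<bullet> (x - c))) =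
       integral S (\<lambda>x. (a \<bullet> (x - c)) * (b \<bullet> (x - c))) + integral S (\<lambda>x. (a \<bullet> (x - c)) * (b' \<bullet> (x - c)))"
      by (subst integral_add[OF Qint Qint, symmetric]) (simp add: inner_add_left distrib_left)
  next
    fix r b
    show "integral S (\<lambda>x. (a \<bullet> (x - c)) * ((r *\<^sub>R b) \<bullet> (x - c))) =
       r *\<^sub>R integral S (\<lambda>x. (a \<bullet> (x - c)) * (b \<bullet> (x - c)))"
      by (subst integral_cmul[symmetric]) (simp add: mult.left_commute)
  qed
  have sym: "Q a b = Q b a" for a b
    by (simp add: Q_def mult.commute)
  have "(\<lambda>a. Q a b) = Q b" for b
    by (rule ext) (rule sym)
  then have bil: "bilinear Q"
    using lin by (simp add: bilinear_def)
  have pos: "0 < Q a a" if a: "a \<noteq> 0" for a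
  proof -
    obtain z where "z \<in> interior S"
      using intS by blast
    then obtain \<epsilon> where z: "\<epsilon> > 0" "cball z \<epsilon> \<subseteq> interior S"
      using open_interior[of S] by (meson open_contains_cball)
    \<comment> \<open>The functional given by \<open>a\<close> separates \<open>z\<close> from
      \<open>z'\<close>, so \<open>a \<bullet> (x - c)\<close> is nonzero at one of these two
      interior points.\<close>
    define z' where "z' = z + (\<epsilon> / norm a) *\<^sub>R a"
    have "z \<in> interior S" "z' \<in> interior S"
      using z a by (auto simp: z'_def dist_norm subset_iff)
    moreover have "a \<bullet> (z - c) \<noteq> 0 \<or> a \<bullet> (z' - c) \<noteq> 0"
      using z(1) a by (auto simp: z'_def inner_add_right inner_diff_right)
    ultimately obtain x where "x \<in> interior S" "a \<bullet> (x - c) \<noteq> 0"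
      by blast
    then show ?thesis
      unfolding Q_def by (intro integral_positive_somewhere[OF S(1)]) (simp_all add: continuous_intros)
  qed
  obtain M :: "real ^ 3 ^ 3" where M: "\<And>a b. Q (M *v a) (M *v b) = a \<bullet> b"
    using orthonormal_basis_for_form[OF bil sym pos] by metis
  have "a = 0" if "M *v a = 0" for a
    using M[of a a] that bilinear_lzero[OF bil] by simp
  then have invM: "invertible M"
    by (simp add: invertible_left_inverse matrix_left_invertible_ker)
  then obtain M' where M': "M ** M' = mat 1" "M' ** M = mat 1"
    by (auto simp: invertible_def)
  have "\<exists>A. orthogonal_matrix A \<and> (\<forall>x\<in>S. transpose M *v (f x - c) = A *v (transpose M *v (x - c)))"
    if f: "affine_map_on S f" and b: "bij_betw f S S" for f
  proof -
    obtain B k where "linear B" and Bk: "\<And>x. x \<in> S \<Longrightarrow> f x = B x + k"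
      using affine_map_on_extend[OF S(2,3) f] by blast
    define A where "A = matrix B"
    define g where "g x = A *v x + k" for x
    have fg: "f x = g x" if "x \<in> S" for x
      using Bk[OF that] \<open>linear B\<close> by (simp add: g_def A_def matrix_works)
    have bg: "bij_betw g S S"
      using b fg bij_betw_cong by metis
    note cov = integral_affine_bij[OF S(1) g_def bg]
    \<comment> \<open>The integrand 1 gives \<open>\<bar>det A\<bar> * V = V\<close> with
      \<open>V > 0\<close>.\<close>
    have "\<bar>det A\<bar> = 1"
      using cov[of "\<lambda>x. 1"] V by (simp add: V_def)
    then have cov: "integral S (\<lambda>x. \<phi> (g x)) = integral S \<phi>" if "continuous_on S \<phi>"
      for \<phi> :: "real ^ 3 \<Rightarrow> real"
      using cov[OF that] by simp
    have gc: "g c = c"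
    proof (rule vector_eq_rdot[THEN iffD1], intro allI)
      fix a
      have "V * (c \<bullet> a) = integral S (\<lambda>x. a \<bullet> x)"
        by (simp only: c inner_commute[of c a])
      also have "\<dots> = integral S (\<lambda>x. a \<bullet> g x)"
        by (rule cov[symmetric]) (intro continuous_intros)
      also have "\<dots> = integral S (\<lambda>x. (transpose A *v a) \<bullet> x + a \<bullet> k)"
        by (simp add: g_def dot_lmul_matrix inner_add_right)
      also have "\<dots> = integral S (\<lambda>x. (transpose A *v a) \<bullet> x) + integral S (\<lambda>x. a \<bullet> k)"
        by (intro integral_add int continuous_intros)
      also have "integral S (\<lambda>x. a \<bullet> k) = V * (a \<bullet> k)"
        using integral_cmul[where c = "a \<bullet> k" and f = "\<lambda>x. 1 :: real" and S = S]
        by (simp add: V_def mult.commute)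
      also have "integral S (\<lambda>x. (transpose A *v a) \<bullet> x) + V * (a \<bullet> k) = V * (g c \<bullet> a)"
        unfolding c by (simp add: g_def dot_lmul_matrix inner_add_right inner_commute[of _ a] distrib_left)
      finally show "g c \<bullet> a = c \<bullet> a"
        using V by simp
    qed
    have gx: "g x - c = A *v (x - c)" for x
      using gc by (simp add: g_def matrix_vector_mult_diff_distrib algebra_simps)
    have QA: "Q (transpose A *v a) (transpose A *v b) = Q a b" for a b
    proof -
      have "Q (transpose A *v a) (transpose A *v b) = integral S (\<lambda>x. (a \<bullet> (g x - c)) * (b \<bullet> (g x - c)))"
        unfolding gx Q_def by (simp add: dot_lmul_matrix)
      also have "\<dots> = Q a b"
        unfolding Q_def by (rule cov[of "\<lambda>x. (a \<bullet> (x - c)) * (b \<bullet> (x - c))"]) (intro continuous_intros)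
      finally show ?thesis .
    qed
    \<comment> \<open>\<open>N\<close> expresses \<open>transpose A\<close> in the
      \<open>Q\<close>-orthonormal basis \<open>M\<close>, so it is orthogonal. Transposing
      \<open>M ** N = transpose A ** M\<close> shows that \<open>A\<close> itself is orthogonal in
      the coordinates \<open>transpose M\<close>.\<close>
    define N where "N = M' ** transpose A ** M"
    have MN: "M ** N = transpose A ** M"
      using M' by (simp add: N_def matrix_mul_assoc)
    then have MN': "transpose M ** A = transpose N ** transpose M"
      by (metis matrix_transpose_mul transpose_transpose)
    have "(N *v a) \<bullet> (N *v b) = a \<bullet> b" for a b
      by (simp add: M[of "N *v a" "N *v b", symmetric] matrix_vector_mul_assoc MN)
        (simp add: QA M del: transpose_matrix_vector flip: matrix_vector_mul_assoc)
    then have "orthogonal_transformation ((*v) N)"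
      by (simp add: orthogonal_transformation_def)
    then have "orthogonal_matrix N"
      by (simp add: orthogonal_transformation_matrix)
    moreover have "transpose M *v (f x - c) = transpose N *v (transpose M *v (x - c))" if "x \<in> S" for x
      by (simp only: fg[OF that] gx matrix_vector_mul_assoc MN')
    ultimately show ?thesis
      by (intro exI[of _ "transpose N"]) simp
  qed
  moreover have "invertible (transpose M)"
    using invM by (simp add: transpose_invertible)
  ultimately show thesis
    using that by blast
qed

section \<open>Infinite groups of orthogonal matrices\<close>

lemma norm_orthogonal_matrix_vector:
  fixes A :: "real ^ 'n ^ 'n"
  assumes "orthogonal_matrix A"
  shows "norm (A *v x) = norm x"
  using assms orthogonal_transformation_matrix[of "(*v) A"] orthogonal_transformation_norm by auto

lemma inner_matrix_columns:
  fixes M :: "real ^ 'n ^ 'm"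
  shows "M \<bullet> M = (\<Sum>j\<in>UNIV. column j M \<bullet> column j M)"
  unfolding inner_vec_def column_def by (simp add: sum.swap[of _ "UNIV :: 'm set"])

lemma column_matrix_matrix_mult:
  fixes A :: "real ^ 'n ^ 'm"
  shows "column j (A ** M) = A *v column j M"
  by (simp add: vec_eq_iff column_def matrix_matrix_mult_def matrix_vector_mult_def)

text \<open>The norm of a matrix is the Frobenius norm, determined by the lengths of the columns,
  and \<open>A\<close> preserves each of these lengths.\<close>

lemma norm_orthogonal_matrix_matrix:
  fixes A :: "real ^ 'n ^ 'n" and M :: "real ^ 'm ^ 'n"
  assumes "orthogonal_matrix A"
  shows "norm (A ** M) = norm M"
  unfolding norm_eq_sqrt_inner inner_matrix_columns column_matrix_matrix_mult
  by (simp add: norm_orthogonal_matrix_vector[OF assms] dot_square_norm)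

lemma bounded_orthogonal_matrices: "bounded {A :: real ^ 'n ^ 'n. orthogonal_matrix A}"
  unfolding bounded_iff
proof (intro exI ballI)
  fix A :: "real ^ 'n ^ 'n"
  assume "A \<in> {A. orthogonal_matrix A}"
  then have "norm A = norm (mat 1 :: real ^ 'n ^ 'n)"
    using norm_orthogonal_matrix_matrix[of A "mat 1"] by simp
  then show "norm A \<le> norm (mat 1 :: real ^ 'n ^ 'n)"
    by simp
qed

text \<open>By compactness \<open>G\<close> has a limit point. If \<open>A\<close> and
  \<open>B\<close> are distinct elements close to it, then \<open>transpose A ** B\<close> is
  exactly as far from the identity as \<open>B\<close> is from \<open>A\<close>.\<close>

lemma infinite_orthogonal_group_near_identity:
  fixes G :: "(real ^ 'n ^ 'n) set"
  assumes inf: "infinite G" and orth: "\<And>A. A \<in> G \<Longrightarrow> orthogonal_matrix A"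
    and group: "\<And>A B. A \<in> G \<Longrightarrow> B \<in> G \<Longrightarrow> transpose A ** B \<in> G" and \<epsilon>: "\<epsilon> > 0"
  obtains A where "A \<in> G" "A \<noteq> mat 1" "norm (A - mat 1) < \<epsilon>"
proof -
  have "bounded G"
    using bounded_subset[OF bounded_orthogonal_matrices] orth by blast
  then have "compact (closure G)"
    by (simp add: compact_closure)
  then obtain l where l: "l islimpt G"
    using inf closure_subset unfolding compact_eq_Bolzano_Weierstrass by metis
  obtain A where A: "A \<in> G" "A \<noteq> l" "dist A l < \<epsilon> / 2"
    using l \<epsilon> unfolding islimpt_approachable by (meson half_gt_zero)
  \<comment> \<open>Choosing \<open>B\<close> strictly closer to \<open>l\<close> than
    \<open>A\<close> ensures \<open>A \<noteq> B\<close>.\<close>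
  have "min (\<epsilon> / 2) (dist A l) > 0"
    using A \<epsilon> by simp
  then obtain B where B: "B \<in> G" "dist B l < min (\<epsilon> / 2) (dist A l)"
    using l unfolding islimpt_approachable by meson
  have "A \<noteq> B"
    using B by auto
  have AA: "transpose A ** A = mat 1"
    using orth[OF A(1)] by (simp add: orthogonal_matrix)
  then have "transpose A ** B - mat 1 = transpose A ** (B - A)"
    using matrix_add_ldistrib[of "transpose A" "B - A" A] by (simp add: AA)
  then have n: "norm (transpose A ** B - mat 1) = norm (B - A)"
    using orth[OF A(1)] by (simp add: norm_orthogonal_matrix_matrix)
  also have "\<dots> < \<epsilon>"
    using A B dist_triangle2[of B A l] by (simp flip: dist_norm)
  finally have "norm (transpose A ** B - mat 1) < \<epsilon>" .
  moreover have "transpose A ** B \<noteq> mat 1"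
    using n \<open>A \<noteq> B\<close> by auto
  ultimately show thesis
    using that group A(1) B(1) by blast
qed

lemma tendsto_matrix_vector_mult:
  fixes K :: "'b \<Rightarrow> real ^ 'n ^ 'm"
  assumes "(K \<longlongrightarrow> L) F"
  shows "((\<lambda>n. K n *v x) \<longlongrightarrow> L *v x) F"
  unfolding matrix_vector_mult_def
  by (intro vec_tendstoI) (auto intro!: tendsto_intros assms)

text \<open>Testing the hypothesis on the basis vectors and on their pairwise sums shows that
  \<open>K\<close> is skew-symmetric; its three free entries are the components of
  \<open>u\<close>.\<close>

lemma skew_is_cross_product:
  fixes K :: "real ^ 3 ^ 3"
  assumes K: "\<And>x. x \<bullet> (K *v x) = 0"
  obtains u where "\<And>x. K *v x = cross3 u x"
proof -
  note eq = K[unfolded matrix_vector_mult_def inner_vec_def sum_3, simplified]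
  have "K $ 1 $ 1 = 0" "K $ 2 $ 2 = 0" "K $ 3 $ 3 = 0"
    using eq[of "axis 1 1"] eq[of "axis 2 1"] eq[of "axis 3 1"] by (simp_all add: axis_def)
  moreover have "K $ 1 $ 2 = - K $ 2 $ 1" "K $ 1 $ 3 = - K $ 3 $ 1" "K $ 2 $ 3 = - K $ 3 $ 2"
    using eq[of "axis 1 1 + axis 2 1"] eq[of "axis 1 1 + axis 3 1"] eq[of "axis 2 1 + axis 3 1"]
      calculation by (simp_all add: axis_def)
  ultimately have "K *v x = cross3 (vector [K $ 3 $ 2, K $ 1 $ 3, K $ 2 $ 1]) x" for x
    by (simp add: vec_eq_iff forall_3 matrix_vector_mult_def sum_3 cross_components algebra_simps)
  then show thesis
    using that by blast
qed

text \<open>A limit \<open>K\<close> of difference quotients of orthogonal matrices at the identity satisfies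
  \<open>x \<bullet> K x = 0\<close>, because \<open>\<parallel>x + t K\<^sub>n x\<parallel> = \<parallel>x\<parallel>\<close>; it is skew and hence a cross product.\<close>

lemma infinitesimal_rotation:
  fixes G :: "(real ^ 3 ^ 3) set"
  assumes inf: "infinite G" and orth: "\<And>A. A \<in> G \<Longrightarrow> orthogonal_matrix A"
    and group: "\<And>A B. A \<in> G \<Longrightarrow> B \<in> G \<Longrightarrow> transpose A ** B \<in> G"
  obtains u and g :: "nat \<Rightarrow> real ^ 3 ^ 3" and t where "norm u = 1" "\<And>n. g n \<in> G" "\<And>n. 0 < t n"
    "\<And>x. (\<lambda>n. (1 / t n) *\<^sub>R (g n *v x - x)) \<longlonglongrightarrow> cross3 u x"
proof -
  have "\<exists>A. A \<in> G \<and> A \<noteq> mat 1 \<and> norm (A - mat 1) < inverse (real (Suc n))" for n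
    using infinite_orthogonal_group_near_identity[OF inf orth group, of "inverse (real (Suc n))"]
    by (metis inverse_positive_iff_positive of_nat_0_less_iff zero_less_Suc)
  then obtain g where g: "\<And>n. g n \<in> G" "\<And>n. g n \<noteq> mat 1"
    and small: "\<And>n. norm (g n - mat 1) < inverse (real (Suc n))"
    by metis
  define t where "t n = norm (g n - mat 1)" for n
  define K where "K n = (1 / t n) *\<^sub>R (g n - mat 1)" for n
  have t: "0 < t n" for n
    using g(2) by (simp add: t_def)
  have t0: "t \<longlonglongrightarrow> 0"
    using small LIMSEQ_inverse_real_of_nat
    by (intro tendsto_sandwich[OF _ _ tendsto_const LIMSEQ_inverse_real_of_nat])
      (auto simp: t_def less_imp_le)
  \<comment> \<open>The quotients are normalized, so a subsequence converges to a limit that is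
    nonzero.\<close>
  have "K n \<in> sphere 0 1" for n
    using t[of n] by (simp add: K_def t_def)
  then obtain L r where L: "L \<in> sphere 0 1" and r: "strict_mono (r :: nat \<Rightarrow> nat)" "(K \<circ> r) \<longlonglongrightarrow> L"
    using compact_sphere[of "0 :: real ^ 3 ^ 3" 1] unfolding compact_def by meson
  have gK: "g n *v x = x + t n *\<^sub>R (K n *v x)" for n x
    using t[of n] by (simp add: K_def matrix_vector_mult_diff_rdistrib flip: scaleR_matrix_vector_assoc)
  have Kx: "(\<lambda>n. K (r n) *v x) \<longlonglongrightarrow> L *v x" for x
    using tendsto_matrix_vector_mult[OF r(2)] by (simp add: o_def)
  have tr: "(\<lambda>n. t (r n)) \<longlonglongrightarrow> 0"
    using LIMSEQ_subseq_LIMSEQ[OF t0 r(1)] by (simp add: o_def)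
  have "x \<bullet> (L *v x) = 0" for x
  proof -
    have "2 * (x \<bullet> (K n *v x)) = - (t n * ((K n *v x) \<bullet> (K n *v x)))" for n
    proof -
      have "(x + t n *\<^sub>R (K n *v x)) \<bullet> (x + t n *\<^sub>R (K n *v x)) = x \<bullet> x"
        unfolding gK[symmetric] using norm_orthogonal_matrix_vector[OF orth[OF g(1)]]
        by (simp add: dot_square_norm)
      then have "t n * (2 * (x \<bullet> (K n *v x)) + t n * ((K n *v x) \<bullet> (K n *v x))) = 0"
        by (simp add: algebra_simps inner_commute)
      then show ?thesis
        using t[of n] by simp
    qed
    moreover have "(\<lambda>n. 2 * (x \<bullet> (K (r n) *v x))) \<longlonglongrightarrow> 2 * (x \<bullet> (L *v x))"
      by (intro tendsto_intros Kx)
    moreover have "(\<lambda>n. - (t (r n) * ((K (r n) *v x) \<bullet> (K (r n) *v x)))) \<longlonglongrightarrow> - (0 * ((L *v x) \<bullet> (L *v x)))"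
      by (intro tendsto_intros Kx tr)
    ultimately show ?thesis
      using LIMSEQ_unique by fastforce
  qed
  then obtain u where u: "\<And>x. L *v x = cross3 u x"
    using skew_is_cross_product by metis
  have "u \<noteq> 0"
  proof
    assume "u = 0"
    then have "L *v x = 0" for x
      using u by simp
    then have "L = 0"
      by (metis matrix_eq matrix_vector_mult_0)
    then show False
      using L by simp
  qed
  \<comment> \<open>Rescaling the step sizes by \<open>norm u\<close> turns the axis into a unit
    vector.\<close>
  have "(\<lambda>n. (1 / (t (r n) * norm u)) *\<^sub>R (g (r n) *v x - x)) \<longlonglongrightarrow> cross3 (u /\<^sub>R norm u) x" for x
  proof -
    have "(\<lambda>n. inverse (norm u) *\<^sub>R (K (r n) *v x)) \<longlonglongrightarrow> inverse (norm u) *\<^sub>R (L *v x)"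
      by (intro tendsto_intros Kx)
    moreover have "inverse (norm u) *\<^sub>R (K n *v x) = (1 / (t n * norm u)) *\<^sub>R (g n *v x - x)" for n
      using t[of n] by (simp add: gK field_simps)
    ultimately show ?thesis
      by (simp add: u cross_mult_left)
  qed
  then show thesis
    using that[of "u /\<^sub>R norm u" "\<lambda>n. g (r n)" "\<lambda>n. t (r n) * norm u"] g(1) t \<open>u \<noteq> 0\<close> by simp
qed

section \<open>Maximizers of linear functionals and cross products\<close>

lemma inner_cross_swap: "x \<bullet> cross3 u y = - (y \<bullet> cross3 u x)"
  by (simp add: cross3_simps)

text \<open>Moving \<open>x0\<close> by \<open>g n\<close> cannot increase the functional, which
  bounds the limit by 0 from above. Moving \<open>x0\<close> by the transposed matrices amounts to
  moving \<open>p\<close> by \<open>g n\<close>; as the cross product with \<open>u\<close> is skew,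
  this gives the opposite bound.\<close>

lemma maximizer_infinitesimal_rotation:
  fixes S :: "(real ^ 3) set"
  assumes SG: "\<And>A x. A \<in> G \<Longrightarrow> x \<in> S \<Longrightarrow> A *v x \<in> S \<and> x v* A \<in> S"
    and g: "\<And>n :: nat. g n \<in> G" and t: "\<And>n. 0 < t n"
    and lim: "\<And>x. (\<lambda>n. (1 / t n) *\<^sub>R (g n *v x - x)) \<longlonglongrightarrow> cross3 u x"
    and x0: "x0 \<in> S" "\<And>x. x \<in> S \<Longrightarrow> p \<bullet> x \<le> p \<bullet> x0"
  shows "p \<bullet> cross3 u x0 = 0"
proof (rule antisym)
  have "p \<bullet> ((1 / t n) *\<^sub>R (g n *v x0 - x0)) \<le> 0" for n
    using x0 SG[OF g x0(1), of n] t[of n] by (simp add: inner_diff_right mult_nonneg_nonpos divide_nonpos_pos)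
  moreover have "(\<lambda>n. p \<bullet> ((1 / t n) *\<^sub>R (g n *v x0 - x0))) \<longlonglongrightarrow> p \<bullet> cross3 u x0"
    by (intro tendsto_intros lim)
  ultimately show "p \<bullet> cross3 u x0 \<le> 0"
    using LIMSEQ_le_const2 by blast
  have "x0 \<bullet> ((1 / t n) *\<^sub>R (g n *v p - p)) \<le> 0" for n
  proof -
    have "x0 \<bullet> (g n *v p) = p \<bullet> (x0 v* g n)"
      by (metis dot_lmul_matrix inner_commute)
    then have "x0 \<bullet> (g n *v p - p) \<le> 0"
      using x0(2)[of "x0 v* g n"] SG[OF g x0(1), of n] by (simp add: inner_diff_right inner_commute[of x0 p])
    then show ?thesis
      using t[of n] by (simp add: divide_nonpos_pos)
  qed
  moreover have "(\<lambda>n. x0 \<bullet> ((1 / t n) *\<^sub>R (g n *v p - p))) \<longlonglongrightarrow> x0 \<bullet> cross3 u p"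
    by (intro tendsto_intros lim)
  ultimately have "x0 \<bullet> cross3 u p \<le> 0"
    using LIMSEQ_le_const2 by blast
  then show "0 \<le> p \<bullet> cross3 u x0"
    by (simp add: inner_cross_swap[of x0])
qed

text \<open>The maximizers form a nonempty compact face, and an extreme point of a face is an
  extreme point of \<open>S\<close>.\<close>

lemma inner_maximized_at_extreme_point:
  fixes S :: "'a::euclidean_space set"
  assumes S: "compact S" "convex S" "S \<noteq> {}"
  obtains x where "x extreme_point_of S" "\<And>y. y \<in> S \<Longrightarrow> p \<bullet> y \<le> p \<bullet> x"
proof -
  have "continuous_on S (\<lambda>x. p \<bullet> x)"
    by (intro continuous_intros)
  then obtain z where z: "z \<in> S" "\<And>y. y \<in> S \<Longrightarrow> p \<bullet> y \<le> p \<bullet> z"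
    using continuous_attains_sup[OF S(1,3), of "\<lambda>x. p \<bullet> x"] by blast
  let ?F = "S \<inter> {x. p \<bullet> x = p \<bullet> z}"
  have face: "?F face_of S"
    using z by (intro face_of_Int_supporting_hyperplane_le S(2)) auto
  have "compact ?F" "convex ?F" "?F \<noteq> {}"
    using S z face face_of_imp_convex by (auto intro!: compact_Int_closed closed_hyperplane)
  then obtain x where x: "x extreme_point_of ?F"
    using extreme_point_exists_convex by metis
  then have "x \<in> ?F"
    by (simp add: extreme_point_of_def)
  moreover have "x extreme_point_of S"
    using extreme_point_of_face[OF face] x by blast
  ultimately show thesis
    using that z by simp
qed

text \<open>\<open>S\<close> is the convex hull of its extreme points, so a hyperplane containing
  all of these would contain the affine hull of \<open>S\<close>.\<close>

lemma extreme_point_off_hyperplane: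
  fixes S :: "'a::euclidean_space set"
  assumes S: "compact S" "convex S" "affine hull S = UNIV" and n: "n \<noteq> 0"
  obtains x where "x extreme_point_of S" "n \<bullet> x \<noteq> b"
proof (rule ccontr)
  assume "\<not> thesis"
  then have "{x. x extreme_point_of S} \<subseteq> {x. n \<bullet> x = b}"
    using that by blast
  then have "convex hull {x. x extreme_point_of S} \<subseteq> {x. n \<bullet> x = b}"
    by (intro hull_minimal convex_hyperplane)
  then have "S \<subseteq> {x. n \<bullet> x = b}"
    using Krein_Milman_Minkowski[OF S(1,2)] by simp
  then have "affine hull S \<subseteq> {x. n \<bullet> x = b}"
    by (intro hull_minimal affine_hyperplane)
  then have "0 \<in> {x. n \<bullet> x = b}" "n \<in> {x. n \<bullet> x = b}"
    unfolding S(3) by blast+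
  then show False
    using n by simp
qed

text \<open>The first two orthogonality conditions make \<open>n\<close> parallel to
  \<open>cross3 u v\<close>, to which it is also orthogonal.\<close>

lemma orthogonal_to_both_and_cross_imp_zero:
  assumes uv: "cross3 u v \<noteq> 0" and n: "n \<bullet> u = 0" "n \<bullet> v = 0" "n \<bullet> cross3 u v = 0"
  shows "n = 0"
proof -
  have "cross3 n (cross3 u v) = 0"
    using n by (simp add: Lagrange)
  then show ?thesis
    using n(3) uv norm_and_cross_eq_0 by blast
qed

text \<open>\<open>cross3 p w\<close> is parallel to \<open>u\<close> because \<open>p\<close> and
  \<open>w\<close> are orthogonal to \<open>u\<close>, and the last hypothesis makes it orthogonal
  to \<open>u\<close>. Hence it vanishes, and \<open>w\<close> is parallel to
  \<open>p\<close>.\<close>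

lemma orthogonal_to_unit_parallel:
  assumes "norm u = 1" "norm p = 1" "u \<bullet> p = 0" "u \<bullet> w = 0" "p \<bullet> cross3 u w = 0"
  shows "w = (p \<bullet> w) *\<^sub>R p"
proof -
  have "cross3 u (cross3 p w) = 0"
    using assms by (simp add: Lagrange)
  moreover have "u \<bullet> cross3 p w = - (p \<bullet> cross3 u w)"
    by (simp add: cross3_simps)
  ultimately have "cross3 p w = 0"
    using assms(1) assms(5) norm_and_cross_eq_0[of u "cross3 p w"] by auto
  then have "cross3 p (cross3 p w) = 0"
    by simp
  then show ?thesis
    using assms(2) by (simp add: Lagrange dot_square_norm)
qed

lemma norm_decompose_along_unit:
  assumes "norm u = 1"
  shows "(norm x)\<^sup>2 = (u \<bullet> x)\<^sup>2 + (norm (x - (u \<bullet> x) *\<^sub>R u))\<^sup>2"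
proof -
  have "u \<bullet> u = 1"
    using assms by (simp add: dot_square_norm)
  then show ?thesis
    unfolding power2_norm_eq_inner by (simp add: algebra_simps inner_commute power2_eq_square)
qed

section \<open>An axis that moves: the ball\<close>

text \<open>For \<open>p\<close> of length \<open>r\<close>, an extreme maximizer is parallel to
  \<open>p\<close> and of the same length, so it is \<open>p\<close> or \<open>- p\<close>.
  Excluding \<open>- p\<close> puts the whole sphere into \<open>S\<close>.\<close>

lemma cball_eq_of_parallel_maximizers:
  fixes S :: "(real ^ 3) set"
  assumes S: "compact S" "convex S" "affine hull S = UNIV" and r: "0 < r"
    and ext: "\<And>x. x extreme_point_of S \<Longrightarrow> norm x = r"
    and Sr: "S \<subseteq> cball 0 r"
    and par: "\<And>p x. x \<in> S \<Longrightarrow> (\<And>y. y \<in> S \<Longrightarrow> p \<bullet> y \<le> p \<bullet> x) \<Longrightarrow> cross3 x p = 0"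
  shows "S = cball 0 r"
proof
  have ne: "S \<noteq> {}"
    using S(3) by auto
  have sphere: "p \<in> S" if p: "norm p = r" for p
  proof -
    obtain x where x: "x extreme_point_of S" "\<And>y. y \<in> S \<Longrightarrow> p \<bullet> y \<le> p \<bullet> x"
      using inner_maximized_at_extreme_point[OF S(1,2) ne] by blast
    then have "cross3 x p = 0"
      using par by (simp add: extreme_point_of_def)
    have "cross3 p (cross3 x p) = 0"
      using \<open>cross3 x p = 0\<close> by simp
    then have xp: "r\<^sup>2 *\<^sub>R x = (p \<bullet> x) *\<^sub>R p"
      using p by (simp add: Lagrange dot_square_norm)
    then have "norm (r\<^sup>2 *\<^sub>R x) = norm ((p \<bullet> x) *\<^sub>R p)"
      by simp
    then have "\<bar>p \<bullet> x\<bar> = r\<^sup>2"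
      using ext[OF x(1)] p r by simp
    then consider "p \<bullet> x = r\<^sup>2" | "p \<bullet> x = - r\<^sup>2"
      by linarith
    then show ?thesis
    proof cases
      case 1
      then have "x = p"
        using xp r by simp
      then show ?thesis
        using x(1) by (simp add: extreme_point_of_def)
    next
      case 2
      \<comment> \<open>Here the maximum of the functional equals the least value that
        Cauchy-Schwarz permits, so all extreme points would lie in one hyperplane.\<close>
      obtain e where e: "e extreme_point_of S" "p \<bullet> e \<noteq> - r\<^sup>2"
        using extreme_point_off_hyperplane[OF S, of p "- r\<^sup>2"] p r by force
      have "p \<bullet> e \<le> - r\<^sup>2"
        using x(2)[of e] e(1) 2 by (simp add: extreme_point_of_def)
      moreover have "- r\<^sup>2 \<le> p \<bullet> e"
        using Cauchy_Schwarz_ineq2[of p e] p ext[OF e(1)] by (simp add: power2_eq_square)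
      ultimately show ?thesis
        using e(2) by simp
    qed
  qed
  show "cball 0 r \<subseteq> S"
  proof
    fix y :: "real ^ 3"
    assume y: "y \<in> cball 0 r"
    obtain d where d: "norm d = 1" "y = norm y *\<^sub>R d"
      using unit_vector_direction by blast
    have "r *\<^sub>R d \<in> S" "- (r *\<^sub>R d) \<in> S"
      using d(1) r by (auto intro!: sphere)
    then have "((1 + norm y / r) / 2) *\<^sub>R (r *\<^sub>R d) + ((1 - norm y / r) / 2) *\<^sub>R (- (r *\<^sub>R d)) \<in> S"
      using y r by (intro convexD[OF S(2)]) (auto simp: field_simps)
    moreover have "((1 + norm y / r) / 2) *\<^sub>R (r *\<^sub>R d) + ((1 - norm y / r) / 2) *\<^sub>R (- (r *\<^sub>R d))
        = ((1 + norm y / r) / 2 * r - (1 - norm y / r) / 2 * r) *\<^sub>R d"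
      unfolding scaleR_left_diff_distrib by simp
    moreover have "(1 + norm y / r) / 2 * r - (1 - norm y / r) / 2 * r = norm y"
      using r by (simp add: field_simps)
    ultimately show "y \<in> S"
      using d(2) by simp
  qed
qed (use Sr in blast)

section \<open>An axis that is preserved: two parallel circles\<close>

text \<open>The origin is the midpoint of \<open>s i\<close> and \<open>- s i\<close>, so each
  functional is at least 1/2 there, while their sum is 1.\<close>

lemma symmetric_distinguishable_le_2:
  fixes S :: "'a::real_vector set"
  assumes sym: "\<And>x. x \<in> S \<Longrightarrow> - x \<in> S" and S: "convex S" "S \<noteq> {}" and d: "distinguishable S l s"
  shows "l \<le> 2"
proof -
  obtain e where sS: "\<And>i. i \<in> {1..l} \<Longrightarrow> s i \<in> S"
    and e: "\<And>i. i \<in> {1..l} \<Longrightarrow> affine_map_on S (e i)" "\<And>i x. i \<in> {1..l} \<Longrightarrow> x \<in> S \<Longrightarrow> 0 \<le> e i x"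
      "\<And>x. x \<in> S \<Longrightarrow> (\<Sum>i=1..l. e i x) = (1::real)" "\<And>i. i \<in> {1..l} \<Longrightarrow> e i (s i) = 1"
    using d unfolding distinguishable_def by blast
  have "1 / 2 \<le> e i 0" if i: "i \<in> {1..l}" for i
    using affine_map_onD[OF e(1)[OF i] sS[OF i] sym[OF sS[OF i]], of "1 / 2"]
      e(4)[OF i] e(2)[OF i sym[OF sS[OF i]]] by simp
  then have "(\<Sum>i=1..l. 1 / 2 :: real) \<le> (\<Sum>i=1..l. e i 0)"
    by (intro sum_mono) auto
  moreover have "0 \<in> S"
  proof -
    obtain x where "x \<in> S"
      using S(2) by blast
    then show ?thesis
      using convex_mem[OF S(1) _ sym, of x x "1 / 2"] by simp
  qed
  ultimately show ?thesis
    using e(3)[of 0] by simp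
qed

text \<open>If all extreme points have height \<open>\<plusminus>\<eta>\<close> over the plane orthogonal to \<open>u\<close>, then maximizing
  \<open>p + K u\<close> for large \<open>K\<close> produces every point of the circle at height \<open>\<eta>\<close>.\<close>

lemma circle_of_extreme_points:
  fixes S :: "(real ^ 3) set"
  assumes S: "compact S" "convex S" "affine hull S = UNIV"
    and ext: "\<And>x. x extreme_point_of S \<Longrightarrow> norm x = r"
    and \<eta>: "0 < \<eta>" and height: "\<And>x. x extreme_point_of S \<Longrightarrow> \<bar>u \<bullet> x\<bar> = \<eta>"
    and top: "e extreme_point_of S" "u \<bullet> e = \<eta>" and u: "norm u = 1"
    and max: "\<And>p x. x \<in> S \<Longrightarrow> (\<And>y. y \<in> S \<Longrightarrow> p \<bullet> y \<le> p \<bullet> x) \<Longrightarrow> p \<bullet> cross3 u x = 0"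
    and p: "norm p = 1" "u \<bullet> p = 0"
  shows "sqrt (r\<^sup>2 - \<eta>\<^sup>2) *\<^sub>R p + \<eta> *\<^sub>R u \<in> S"
proof -
  define \<rho> where "\<rho> = sqrt (r\<^sup>2 - \<eta>\<^sup>2)"
  have ne: "S \<noteq> {}"
    using S(3) by auto
  have uu: "u \<bullet> u = 1"
    using u by (simp add: dot_square_norm)
  have key: "\<exists>x \<sigma>. x extreme_point_of S \<and> u \<bullet> x = \<eta> \<and> (\<forall>y. y extreme_point_of S \<longrightarrow> u \<bullet> y = \<eta> \<longrightarrow> q \<bullet> y \<le> q \<bullet> x)
      \<and> x = \<sigma> *\<^sub>R q + \<eta> *\<^sub>R u \<and> \<bar>\<sigma>\<bar> = \<rho>"
    if q: "norm q = 1" "u \<bullet> q = 0" for q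
  proof -
    \<comment> \<open>The second term contributes \<open>r + 1\<close> or \<open>- (r + 1)\<close>
      at an extreme point, whereas \<open>q\<close> varies only between \<open>- r\<close> and
      \<open>r\<close>. Every extreme maximizer of \<open>P\<close> is therefore at height
      \<open>\<eta>\<close>.\<close>
    define P where "P = q + ((r + 1) / \<eta>) *\<^sub>R u"
    obtain x where x: "x extreme_point_of S" "\<And>y. y \<in> S \<Longrightarrow> P \<bullet> y \<le> P \<bullet> x"
      using inner_maximized_at_extreme_point[OF S(1,2) ne] by blast
    have Pe: "P \<bullet> y = q \<bullet> y + (r + 1) / \<eta> * (u \<bullet> y)" for y
      by (simp add: P_def inner_add_left)
    have qr: "\<bar>q \<bullet> y\<bar> \<le> r" if "y extreme_point_of S" for y
      using Cauchy_Schwarz_ineq2[of q y] q ext[OF that] by simp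
    have "u \<bullet> x = \<eta>"
    proof (rule ccontr)
      assume "u \<bullet> x \<noteq> \<eta>"
      then have "u \<bullet> x = - \<eta>"
        using height[OF x(1)] by linarith
      then have "q \<bullet> e + (r + 1) \<le> q \<bullet> x - (r + 1)"
        using x(2)[of e] top \<eta> by (simp add: Pe extreme_point_of_def)
      then show False
        using qr[OF x(1)] qr[OF top(1)] by linarith
    qed
    moreover have "q \<bullet> y \<le> q \<bullet> x" if "y extreme_point_of S" "u \<bullet> y = \<eta>" for y
      using x(2)[of y] that \<open>u \<bullet> x = \<eta>\<close> by (simp add: Pe extreme_point_of_def)
    moreover
    define w where "w = x - \<eta> *\<^sub>R u"
    have "P \<bullet> cross3 u x = 0"
      using x by (intro max) (auto simp: extreme_point_of_def)
    then have "q \<bullet> cross3 u x = 0"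
      by (simp add: Pe dot_cross_self)
    then have "q \<bullet> cross3 u w = 0"
      by (simp add: w_def Cross3.right_diff_distrib cross_mult_right)
    moreover have "u \<bullet> w = 0"
      using \<open>u \<bullet> x = \<eta>\<close> uu by (simp add: w_def inner_diff_right)
    ultimately have w: "w = (q \<bullet> w) *\<^sub>R q"
      using orthogonal_to_unit_parallel[OF u q] by blast
    have "(norm w)\<^sup>2 = r\<^sup>2 - \<eta>\<^sup>2"
      using norm_decompose_along_unit[OF u, of x] ext[OF x(1)] \<open>u \<bullet> x = \<eta>\<close> by (simp add: w_def)
    then have "norm w = \<rho>"
      unfolding \<rho>_def by (metis norm_ge_zero real_sqrt_unique)
    then have "\<bar>q \<bullet> w\<bar> = \<rho>"
      using w q(1) by (metis mult.right_neutral norm_scaleR)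
    moreover have "x = (q \<bullet> w) *\<^sub>R q + \<eta> *\<^sub>R u"
      using w by (simp add: w_def)
    ultimately show ?thesis
      using x(1) \<open>u \<bullet> x = \<eta>\<close> \<open>\<And>y. y extreme_point_of S \<Longrightarrow> u \<bullet> y = \<eta> \<Longrightarrow> q \<bullet> y \<le> q \<bullet> x\<close> by blast
  qed
  obtain x \<sigma> where x: "x extreme_point_of S" "x = \<sigma> *\<^sub>R p + \<eta> *\<^sub>R u" "\<bar>\<sigma>\<bar> = \<rho>"
    and xmax: "\<And>y. y extreme_point_of S \<Longrightarrow> u \<bullet> y = \<eta> \<Longrightarrow> p \<bullet> y \<le> p \<bullet> x"
    using key[OF p] by blast
  \<comment> \<open>The sign of \<open>\<sigma>\<close> is still open. The orthogonal direction
    \<open>q\<close> supplies an extreme point at height \<open>\<eta>\<close> where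
    \<open>p\<close> takes the value 0, and comparison with it gives
    \<open>0 \<le> \<sigma>\<close>.\<close>
  define q where "q = cross3 u p"
  have "(norm q)\<^sup>2 = 1"
    unfolding q_def norm_cross using u p by simp
  then have "norm q = 1"
    unfolding power2_eq_1_iff using norm_ge_zero[of q] by linarith
  moreover have uq: "u \<bullet> q = 0" "p \<bullet> q = 0"
    by (simp_all add: q_def dot_cross_self)
  ultimately obtain y \<tau> where y: "y extreme_point_of S" "u \<bullet> y = \<eta>" "y = \<tau> *\<^sub>R q + \<eta> *\<^sub>R u"
    using key[of q] by blast
  have "p \<bullet> y = 0"
    using y(3) uq p by (simp add: inner_add_right inner_commute)
  moreover have "p \<bullet> x = \<sigma>"
    using p x(2) by (simp add: inner_add_right dot_square_norm inner_commute)
  ultimately have "0 \<le> \<sigma>"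
    using xmax[OF y(1,2)] by simp
  then have "\<sigma> = \<rho>"
    using x(3) by simp
  then show ?thesis
    using x(1,2) by (simp add: \<rho>_def extreme_point_of_def)
qed

text \<open>\<open>S\<close> is centrally symmetric, so spectrality writes the point
  \<open>z\<close> at half height on the axis with at most two extreme points. They lie on opposite
  circles with weights 3/4 and 1/4, and their horizontal parts, of equal length, cancel only if the
  circles are single points. Then \<open>S\<close> would lie on the axis.\<close>

lemma two_circles_no_spectrality:
  fixes S :: "(real ^ 3) set"
  assumes S: "compact S" "convex S" "affine hull S = UNIV" and sp: "has_spectrality S"
    and ext: "\<And>x. x extreme_point_of S \<Longrightarrow> norm x = r"
    and height: "\<And>x. x extreme_point_of S \<Longrightarrow> \<bar>u \<bullet> x\<bar> = \<eta>" and u: "norm u = 1"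
    and max: "\<And>p x. x \<in> S \<Longrightarrow> (\<And>y. y \<in> S \<Longrightarrow> p \<bullet> y \<le> p \<bullet> x) \<Longrightarrow> p \<bullet> cross3 u x = 0"
  shows False
proof -
  have "u \<noteq> 0"
    using u by auto
  have uu: "u \<bullet> u = 1"
    using u by (simp add: dot_square_norm)
  obtain e where e: "e extreme_point_of S" "u \<bullet> e \<noteq> \<eta>"
    using extreme_point_off_hyperplane[OF S \<open>u \<noteq> 0\<close>] by blast
  obtain e' where e': "e' extreme_point_of S" "u \<bullet> e' \<noteq> - \<eta>"
    using extreme_point_off_hyperplane[OF S \<open>u \<noteq> 0\<close>] by blast
  have bot: "- u \<bullet> e = \<eta>" and top: "u \<bullet> e' = \<eta>"
    using height[OF e(1)] height[OF e'(1)] e(2) e'(2) by (simp_all add: abs_if split: if_splits)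
  have \<eta>: "0 < \<eta>"
    using height[OF e(1)] e(2) by linarith
  have max': "p \<bullet> cross3 (- u) x = 0" if "x \<in> S" "\<And>y. y \<in> S \<Longrightarrow> p \<bullet> y \<le> p \<bullet> x" for p x
    using max[OF that] by simp
  define \<rho> where "\<rho> = sqrt (r\<^sup>2 - \<eta>\<^sup>2)"
  have up: "\<rho> *\<^sub>R p + \<eta> *\<^sub>R u \<in> S" if "norm p = 1" "u \<bullet> p = 0" for p
    unfolding \<rho>_def
    by (rule circle_of_extreme_points[OF S ext \<eta> height e'(1) top u max that])
  have down: "\<rho> *\<^sub>R p - \<eta> *\<^sub>R u \<in> S" if "norm p = 1" "u \<bullet> p = 0" for p
  proof -
    have "\<bar>- u \<bullet> x\<bar> = \<eta>" if "x extreme_point_of S" for x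
      using height[OF that] by simp
    moreover have "norm (- u) = 1" "- u \<bullet> p = 0"
      using u that by auto
    ultimately have "\<rho> *\<^sub>R p + \<eta> *\<^sub>R (- u) \<in> S"
      unfolding \<rho>_def
      by (intro circle_of_extreme_points[OF S ext \<eta> _ e(1) bot _ max' that(1)])
    then show ?thesis
      by simp
  qed
  have "cross3 u (axis 1 1) \<noteq> 0 \<or> cross3 u (axis 2 1) \<noteq> 0 \<or> cross3 u (axis 3 1) \<noteq> 0"
    by (rule cross_basis_nonzero[OF \<open>u \<noteq> 0\<close>])
  then obtain a where "cross3 u a \<noteq> 0"
    by blast
  then have "norm (cross3 u a /\<^sub>R norm (cross3 u a)) = 1" "u \<bullet> (cross3 u a /\<^sub>R norm (cross3 u a)) = 0"
    by (simp_all add: dot_cross_self)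
  then obtain p0 where p0: "norm p0 = 1" "u \<bullet> p0 = 0"
    by blast
  have decomp: "(norm (x - (u \<bullet> x) *\<^sub>R u))\<^sup>2 = r\<^sup>2 - \<eta>\<^sup>2" if "x extreme_point_of S" for x
  proof -
    have "(u \<bullet> x)\<^sup>2 = \<eta>\<^sup>2"
      using height[OF that] by (metis power2_abs)
    then show ?thesis
      using norm_decompose_along_unit[OF u, of x] ext[OF that] by simp
  qed
  have sym_ext: "- x \<in> S" if x: "x extreme_point_of S" for x
  proof -
    define w where "w = - (x - (u \<bullet> x) *\<^sub>R u)"
    have "norm w = \<rho>"
      using decomp[OF x] unfolding \<rho>_def w_def norm_minus_cancel by (metis norm_ge_zero real_sqrt_unique)
    have "u \<bullet> w = 0"
      using uu by (simp add: w_def inner_diff_right)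
    \<comment> \<open>If \<open>w = 0\<close>, then \<open>\<rho> = 0\<close> and any horizontal
      direction such as \<open>p0\<close> serves.\<close>
    obtain p where p: "norm p = 1" "u \<bullet> p = 0" "w = \<rho> *\<^sub>R p"
    proof (cases "w = 0")
      case True
      then show thesis
        using that p0 \<open>norm w = \<rho>\<close> by auto
    next
      case False
      then show thesis
        using that[of "w /\<^sub>R norm w"] \<open>norm w = \<rho>\<close> \<open>u \<bullet> w = 0\<close> by auto
    qed
    have "- x = \<rho> *\<^sub>R p - (u \<bullet> x) *\<^sub>R u"
      unfolding p(3)[symmetric] by (simp add: w_def)
    moreover have "u \<bullet> x = \<eta> \<or> u \<bullet> x = - \<eta>"
      using height[OF x] by linarith
    ultimately show ?thesis
      using up[OF p(1,2)] down[OF p(1,2)] by auto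
  qed
  have "S \<subseteq> uminus ` S"
  proof -
    have "convex hull {x. x extreme_point_of S} \<subseteq> uminus ` S"
      using sym_ext by (intro hull_minimal convex_negations S(2)) (force simp: image_iff)
    then show ?thesis
      using Krein_Milman_Minkowski[OF S(1,2)] by simp
  qed
  then have sym: "- x \<in> S" if "x \<in> S" for x
    using that by force
  have "\<rho> *\<^sub>R p0 + \<eta> *\<^sub>R u \<in> S" "\<rho> *\<^sub>R (- p0) + \<eta> *\<^sub>R u \<in> S"
      "\<rho> *\<^sub>R p0 - \<eta> *\<^sub>R u \<in> S" "\<rho> *\<^sub>R (- p0) - \<eta> *\<^sub>R u \<in> S"
    using up[of p0] up[of "- p0"] down[of p0] down[of "- p0"] p0 by auto
  \<comment> \<open>The centres of the two circles are midpoints of diameters; \<open>z\<close> then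
    divides the segment between the centres.\<close>
  note mid = convex_mem[OF S(2) this(1,2), of "1 / 2"] convex_mem[OF S(2) this(3,4), of "1 / 2"]
  moreover have "(1 - 1 / 2) *\<^sub>R (\<rho> *\<^sub>R p0 + \<eta> *\<^sub>R u) + (1 / 2) *\<^sub>R (\<rho> *\<^sub>R (- p0) + \<eta> *\<^sub>R u) = \<eta> *\<^sub>R u"
      "(1 - 1 / 2) *\<^sub>R (\<rho> *\<^sub>R p0 - \<eta> *\<^sub>R u) + (1 / 2) *\<^sub>R (\<rho> *\<^sub>R (- p0) - \<eta> *\<^sub>R u) = - (\<eta> *\<^sub>R u)"
    by (simp_all add: vec_eq_iff field_simps)
  ultimately have "\<eta> *\<^sub>R u \<in> S" "- (\<eta> *\<^sub>R u) \<in> S"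
    by simp_all
  note convex_mem[OF S(2) this, of "1 / 4"]
  moreover define z where "z = (\<eta> / 2) *\<^sub>R u"
  moreover have "(1 - 1 / 4) *\<^sub>R (\<eta> *\<^sub>R u) + (1 / 4) *\<^sub>R - (\<eta> *\<^sub>R u) = z"
    by (simp add: z_def vec_eq_iff field_simps)
  ultimately have "z \<in> S"
    by simp
  then obtain l s c where l: "l \<ge> 1" and s: "\<forall>j\<in>{1..l}. s j extreme_point_of S"
    and d: "distinguishable S l s"
    and c: "\<forall>j\<in>{1..l}. (0::real) \<le> c j" "(\<Sum>j=1..l. c j) = 1" and zs: "z = (\<Sum>j=1..l. c j *\<^sub>R s j)"
    using sp unfolding has_spectrality_def by blast
  have uz: "u \<bullet> z = \<eta> / 2"
    by (simp add: z_def uu)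
  have "l \<le> 2"
    using sym S(2) \<open>z \<in> S\<close> by (intro symmetric_distinguishable_le_2[OF _ _ _ d]) auto
  have "l \<noteq> 1"
  proof
    assume "l = 1"
    then have "\<bar>u \<bullet> z\<bar> = \<eta>"
      using zs c(2) s height by simp
    then show False
      using uz \<eta> by simp
  qed
  then have l2: "l = 2"
    using l \<open>l \<le> 2\<close> by simp
  then have s12: "s 1 extreme_point_of S" "s 2 extreme_point_of S"
    using s by auto
  have c12: "0 \<le> c 1" "0 \<le> c 2" "c 1 + c 2 = 1" and z12: "z = c 1 *\<^sub>R s 1 + c 2 *\<^sub>R s 2"
    using c zs l2 by (auto simp: numeral_2_eq_2)
  have extreme_only: "\<eta>\<^sup>2 = r\<^sup>2"
    if ab: "a extreme_point_of S" "b extreme_point_of S" "u \<bullet> a = \<eta>" "u \<bullet> b = - \<eta>"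
      and k: "k + k' = (1::real)" "z = k *\<^sub>R a + k' *\<^sub>R b" for a b k k'
  proof -
    have "k * \<eta> - k' * \<eta> = \<eta> / 2"
      using arg_cong[OF k(2), of "\<lambda>x. u \<bullet> x"] uz ab by (simp add: inner_add_right)
    then have "(k - k') * \<eta> = 1 / 2 * \<eta>"
      by (simp add: left_diff_distrib)
    then have "k - k' = 1 / 2"
      using \<eta> by (simp only: mult_cancel_right) simp
    then have kk: "k = 3 / 4" "k' = 1 / 4"
      using k(1) by auto
    define wa where "wa = a - \<eta> *\<^sub>R u"
    define wb where "wb = b + \<eta> *\<^sub>R u"
    have nw: "(norm wa)\<^sup>2 = r\<^sup>2 - \<eta>\<^sup>2" "(norm wb)\<^sup>2 = r\<^sup>2 - \<eta>\<^sup>2"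
      using decomp[OF ab(1)] decomp[OF ab(2)] ab(3,4) by (auto simp: wa_def wb_def)
    have "(4::real) *\<^sub>R z = 3 *\<^sub>R a + b"
      by (simp add: k(2) kk scaleR_add_right)
    then have "b = (2 * \<eta>) *\<^sub>R u - 3 *\<^sub>R a"
      by (simp add: z_def algebra_simps)
    \<comment> \<open>The horizontal part of \<open>z\<close> is 0, which forces this ratio although
      \<open>wa\<close> and \<open>wb\<close> have equal norm.\<close>
    then have "wb = - (3 *\<^sub>R wa)"
      by (simp add: wa_def wb_def vec_eq_iff algebra_simps)
    then have "(norm wb)\<^sup>2 = 9 * (norm wa)\<^sup>2"
      by (simp add: power_mult_distrib)
    then show ?thesis
      using nw by simp
  qed
  have "u \<bullet> s 1 = \<eta> \<or> u \<bullet> s 1 = - \<eta>" "u \<bullet> s 2 = \<eta> \<or> u \<bullet> s 2 = - \<eta>"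
    using height[OF s12(1)] height[OF s12(2)] by linarith+
  moreover have "u \<bullet> s 1 \<noteq> u \<bullet> s 2"
  proof
    assume eq: "u \<bullet> s 1 = u \<bullet> s 2"
    then have "u \<bullet> z = (c 1 + c 2) * (u \<bullet> s 1)"
      by (simp add: z12 inner_add_right distrib_right)
    then have "\<bar>u \<bullet> z\<bar> = \<eta>"
      using c12(3) height[OF s12(1)] by simp
    then show False
      using uz \<eta> by simp
  qed
  ultimately consider "u \<bullet> s 1 = \<eta>" "u \<bullet> s 2 = - \<eta>" | "u \<bullet> s 2 = \<eta>" "u \<bullet> s 1 = - \<eta>"
    by fastforce
  then have "\<eta>\<^sup>2 = r\<^sup>2"
  proof cases
    case 1
    then show ?thesis
      using extreme_only[OF s12 _ _ c12(3) z12] by blast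
  next
    case 2
    then show ?thesis
      using c12(3) z12 by (intro extreme_only[OF s12(2,1), of "c 2" "c 1"]) (auto simp: add.commute)
  qed
  have "x - (u \<bullet> x) *\<^sub>R u = 0" if "x extreme_point_of S" for x
    using decomp[OF that] \<open>\<eta>\<^sup>2 = r\<^sup>2\<close> by simp
  then have on_axis: "p0 \<bullet> x = 0" if "x extreme_point_of S" for x
    using p0(2) that by (metis eq_iff_diff_eq_0 inner_commute inner_scaleR_right mult_zero_right)
  moreover have "p0 \<noteq> 0"
    using p0 by auto
  ultimately show False
    using extreme_point_off_hyperplane[OF S, of p0 0] by blast
qed

section \<open>From orthogonal symmetries to the ball\<close>

text \<open>The inverse symmetry takes a maximizer of \<open>p\<close> to a maximizer of
  \<open>p v* h\<close>. The condition \<open>max\<close> there is a triple product, and carrying it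
  back by \<open>h\<close> only introduces the nonzero factor \<open>det h\<close>.\<close>

lemma maximizer_orthogonal_to_rotated_axis:
  fixes S :: "(real ^ 3) set"
  assumes h: "orthogonal_matrix h" "\<And>x. x \<in> S \<Longrightarrow> h *v x \<in> S \<and> x v* h \<in> S"
    and max: "\<And>p x. x \<in> S \<Longrightarrow> (\<And>y. y \<in> S \<Longrightarrow> p \<bullet> y \<le> p \<bullet> x) \<Longrightarrow> p \<bullet> cross3 u x = 0"
    and x: "x \<in> S" "\<And>y. y \<in> S \<Longrightarrow> p \<bullet> y \<le> p \<bullet> x"
  shows "cross3 x p \<bullet> (h *v u) = 0"
proof -
  have hx: "h *v (x v* h) = x"
    using h(1) by (simp add: orthogonal_matrix_def matrix_vector_mul_assoc flip: transpose_matrix_vector)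
  have "(p v* h) \<bullet> cross3 u (x v* h) = 0"
    using x h(2) by (intro max) (auto simp: dot_lmul_matrix hx)
  then have "u \<bullet> cross3 (x v* h) (p v* h) = 0"
    by (metis cross_triple inner_commute)
  moreover have "cross3 (x v* h) (p v* h) = det h *\<^sub>R (cross3 x p v* h)"
    using cross_orthogonal_matrix[of "transpose h" x p] h(1) by simp
  moreover have "det h \<noteq> 0"
    using det_orthogonal_matrix[OF h(1)] by auto
  ultimately have "u \<bullet> (cross3 x p v* h) = 0"
    by simp
  then show ?thesis
    by (metis dot_lmul_matrix inner_commute)
qed

text \<open>Since there are infinitely many symmetries, there is an infinitesimal rotation about some axis
  \<open>u\<close>. If a symmetry \<open>h\<close> moves the line of \<open>u\<close>, then \<open>u\<close>, \<open>h u\<close> and \<open>u \<times> h u\<close> span the space, and \<open>S\<close>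
  contains the full sphere; otherwise the extreme points lie on two parallel circles.\<close>

lemma ball_of_orthogonal_symmetries:
  fixes S :: "(real ^ 3) set"
  assumes S: "compact S" "convex S" "affine hull S = UNIV" and sp: "has_spectrality S"
    and inf: "infinite {x. x extreme_point_of S}"
    and trans: "\<And>x y. x extreme_point_of S \<Longrightarrow> y extreme_point_of S \<Longrightarrow>
      \<exists>A. orthogonal_matrix A \<and> (*v) A ` S = S \<and> A *v x = y"
  obtains r where "0 < r" "S = cball 0 r"
proof -
  define G where "G = {A. orthogonal_matrix A \<and> (*v) A ` S = S}"
  have orth: "orthogonal_matrix A" if "A \<in> G" for A
    using that by (simp add: G_def)
  obtain x0 where x0: "x0 extreme_point_of S"
    using inf not_finite_existsD by blast
  define r where "r = norm x0"
  have toG: "\<exists>A\<in>G. A *v x0 = x" if "x extreme_point_of S" for x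
    using trans[OF x0 that] by (auto simp: G_def)
  have ext: "norm x = r" if "x extreme_point_of S" for x
    using toG[OF that] norm_orthogonal_matrix_vector[OF orth] by (auto simp: r_def)
  have "r \<noteq> 0"
  proof
    assume "r = 0"
    then have "{x. x extreme_point_of S} \<subseteq> {0}"
      using ext by auto
    then show False
      using inf finite_subset by blast
  qed
  then have r: "0 < r"
    by (simp add: r_def)
  have "convex hull {x. x extreme_point_of S} \<subseteq> cball 0 r"
    using ext by (intro hull_minimal) auto
  then have Sr: "S \<subseteq> cball 0 r"
    using Krein_Milman_Minkowski[OF S(1,2)] by simp
  have "{x. x extreme_point_of S} \<subseteq> (\<lambda>A. A *v x0) ` G"
    using toG by force
  then have infG: "infinite G"
    using inf finite_surj by blast
  have transposeG: "transpose A \<in> G" if "A \<in> G" for A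
  proof -
    have "(*v) (transpose A) ` (*v) A ` S = S"
      unfolding image_image matrix_vector_mul_assoc using orth[OF that] by (simp add: orthogonal_matrix)
    then show ?thesis
      using that by (simp add: G_def)
  qed
  have SG: "A *v x \<in> S \<and> x v* A \<in> S" if "A \<in> G" "x \<in> S" for A x
    using that transposeG[OF that(1)] unfolding G_def
    by (metis (mono_tags, lifting) imageI mem_Collect_eq transpose_matrix_vector)
  have prodG: "A ** B \<in> G" if "A \<in> G" "B \<in> G" for A B
  proof -
    have "(*v) (A ** B) ` S = (*v) A ` (*v) B ` S"
      by (simp add: image_image matrix_vector_mul_assoc)
    then show ?thesis
      using that by (simp add: G_def orthogonal_matrix_mul)
  qed
  obtain u and g :: "nat \<Rightarrow> real ^ 3 ^ 3" and t where u: "norm u = 1" and g: "\<And>n. g n \<in> G"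
    and t: "\<And>n. 0 < t n" and lim: "\<And>x. (\<lambda>n. (1 / t n) *\<^sub>R (g n *v x - x)) \<longlonglongrightarrow> cross3 u x"
    by (rule infinitesimal_rotation[of G]) (use infG orth prodG[OF transposeG] that in blast)+
  have max: "p \<bullet> cross3 u x = 0" if "x \<in> S" "\<And>y. y \<in> S \<Longrightarrow> p \<bullet> y \<le> p \<bullet> x" for p x
    by (rule maximizer_infinitesimal_rotation[OF SG g t lim that])
  show thesis
  proof (cases "\<exists>h\<in>G. cross3 u (h *v u) \<noteq> 0")
    case True
    then obtain h where h: "h \<in> G" "cross3 u (h *v u) \<noteq> 0"
      by blast
    have par: "cross3 x p = 0" if x: "x \<in> S" "\<And>y. y \<in> S \<Longrightarrow> p \<bullet> y \<le> p \<bullet> x" for p x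
    proof -
      have star: "cross3 x p \<bullet> (h' *v u) = 0" if "h' \<in> G" for h'
        using orth[OF that] SG[OF that] max x by (rule maximizer_orthogonal_to_rotated_axis)
      \<comment> \<open>Both \<open>h\<close> and \<open>g n ** h\<close> are symmetries, so
        \<open>cross3 x p\<close> is orthogonal to both images of \<open>u\<close>. In the limit of
        the difference quotients it is orthogonal to \<open>cross3 u (h *v u)\<close> as
        well.\<close>
      have "cross3 x p \<bullet> ((1 / t n) *\<^sub>R (g n *v (h *v u) - h *v u)) = 0" for n
        using star[OF h(1)] star[OF prodG[OF g h(1)], of n]
        by (simp add: inner_diff_right matrix_vector_mul_assoc)
      moreover have "(\<lambda>n. cross3 x p \<bullet> ((1 / t n) *\<^sub>R (g n *v (h *v u) - h *v u)))
          \<longlonglongrightarrow> cross3 x p \<bullet> cross3 u (h *v u)"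
        by (intro tendsto_intros lim)
      ultimately have "cross3 x p \<bullet> cross3 u (h *v u) = 0"
        by (simp only: LIMSEQ_const_iff)
      moreover have "mat 1 \<in> G"
        by (simp add: G_def orthogonal_matrix_id)
      then have "cross3 x p \<bullet> u = 0"
        using star[of "mat 1"] by simp
      ultimately show ?thesis
        using star[OF h(1)] by (intro orthogonal_to_both_and_cross_imp_zero[OF h(2)])
    qed
    have "S = cball 0 r"
      by (rule cball_eq_of_parallel_maximizers[OF S r ext Sr par])
    then show thesis
      using that r by blast
  next
    case False
    have height: "\<bar>u \<bullet> x\<bar> = \<bar>u \<bullet> x0\<bar>" if x: "x extreme_point_of S" for x
    proof -
      obtain A where A: "A \<in> G" "A *v x0 = x"
        using toG[OF x] by blast
      \<comment> \<open>\<open>w\<close> is the image of \<open>u\<close> under the inverse of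
        \<open>A\<close>. In the present case it is \<open>u\<close> or \<open>- u\<close>, so
        \<open>x\<close> and \<open>x0\<close> have the same absolute height.\<close>
      define w where "w = u v* A"
      have "cross3 u w = 0"
        using False transposeG[OF A(1)] by (force simp: w_def)
      then have "cross3 u (cross3 u w) = 0"
        by simp
      then have w: "w = (u \<bullet> w) *\<^sub>R u"
        using u by (simp add: Lagrange dot_square_norm)
      have "norm w = 1"
        using norm_orthogonal_matrix_vector[OF orth[OF transposeG[OF A(1)]], of u] u by (simp add: w_def)
      then have "\<bar>u \<bullet> w\<bar> = 1"
        using w u by (metis mult.right_neutral norm_scaleR)
      moreover have "u \<bullet> x = w \<bullet> x0"
        by (simp add: w_def dot_lmul_matrix A(2))
      moreover have "w \<bullet> x0 = (u \<bullet> w) * (u \<bullet> x0)"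
        by (subst w) simp
      ultimately show ?thesis
        by (simp add: abs_mult)
    qed
    show thesis
      using two_circles_no_spectrality[OF S sp ext height u max] by blast
  qed
qed

section \<open>Return to affine coordinates and the equivalence\<close>

text \<open>The coordinates \<open>U\<close> turn the automorphisms of \<open>S\<close> into
  orthogonal symmetries of \<open>T\<close>, and all hypotheses pass to \<open>T\<close>. So
  \<open>T\<close> is a ball about the origin, which \<open>V\<close> scales to radius 1.\<close>

lemma affine_isomorphic_unit_ball:
  fixes S :: "(real ^ 3) set"
  assumes S: "compact S" "convex S" "affine hull S = UNIV" and sp: "has_spectrality S"
    and inf: "infinite {x. x extreme_point_of S}"
    and trans: "affine_automorphisms_transitive_on_extreme_points S"
  shows "affine_isomorphic S (cball (0 :: real ^ 3) 1)"
proof -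
  obtain L :: "real ^ 3 ^ 3" and c where L: "invertible L"
    and orth: "\<And>f. affine_map_on S f \<Longrightarrow> bij_betw f S S \<Longrightarrow>
      \<exists>A. orthogonal_matrix A \<and> (\<forall>x\<in>S. L *v (f x - c) = A *v (L *v (x - c)))"
    using affine_automorphisms_orthogonal[OF S] by metis
  define U where "U x = L *v x + - (L *v c)" for x
  have U: "U x = L *v (x - c)" for x
    by (simp add: U_def matrix_vector_mult_diff_distrib)
  have U_affine: "affine_map_on S U"
    unfolding U_def by (rule affine_map_on_linear_add) simp
  have "inj ((*v) L)"
    using L by (simp add: inj_matrix_vector_mult)
  then have U_inj: "inj U"
    by (auto simp: inj_def U_def)
  define T where "T = U ` S"
  have U_bij: "bij_betw U S T"
    using U_inj by (auto simp: T_def bij_betw_def intro: inj_on_subset)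
  have U': "U = (\<lambda>x. - (L *v c) + x) \<circ> (*v) L"
    by (auto simp: U_def)
  have "continuous_on S U"
    unfolding U_def by (intro continuous_intros)
  then have T: "compact T" "convex T"
    unfolding T_def using S(1,2) U_affine by (simp_all add: compact_continuous_image convex_affine_image)
  have "affine hull T = UNIV"
  proof -
    have "affine hull T = (\<lambda>x. - (L *v c) + x) ` (*v) L ` (affine hull S)"
      unfolding T_def U' image_comp[symmetric] affine_hull_translation
      by (subst affine_hull_linear_image) (auto simp: linear_linear)
    then show ?thesis
      using S(3) L matrix_right_invertible_surjective[of L] by (auto simp: invertible_def surj_plus)
  qed
  note T = T this
  have spT: "has_spectrality T"
    by (rule has_spectrality_affine_bij[OF S(2) U_affine U_bij sp])
  have ext_im: "x extreme_point_of T \<Longrightarrow> \<exists>y. y extreme_point_of S \<and> x = U y" for x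
    using extreme_point_affine_bij_image[OF T(2) affine_map_on_inv_into[OF S(2) U_affine U_bij]
        bij_betw_inv_into[OF U_bij]] U_bij
    by (metis bij_betw_inv_into_right extreme_point_of_def)
  have infT: "infinite {x. x extreme_point_of T}"
  proof
    assume "finite {x. x extreme_point_of T}"
    moreover have "U ` {x. x extreme_point_of S} \<subseteq> {x. x extreme_point_of T}"
      using extreme_point_affine_bij_image[OF S(2) U_affine U_bij] by auto
    ultimately show False
      using inf U_inj by (metis finite_imageD finite_subset inj_on_subset subset_UNIV)
  qed
  have "\<exists>A. orthogonal_matrix A \<and> (*v) A ` T = T \<and> A *v x = y"
    if xy: "x extreme_point_of T" "y extreme_point_of T" for x y
  proof -
    obtain a b where ab: "a extreme_point_of S" "x = U a" "b extreme_point_of S" "y = U b"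
      using ext_im xy by metis
    then obtain f where f: "affine_map_on S f" "bij_betw f S S" "f a = b"
      using trans affine_automorphisms_transitive_iff[OF S(2)] by blast
    obtain A where A: "orthogonal_matrix A" "\<And>x. x \<in> S \<Longrightarrow> U (f x) = A *v U x"
      using orth[OF f(1,2)] U by metis
    have "(*v) A ` T = U ` f ` S"
      using A(2) by (auto simp: T_def image_image intro!: image_cong)
    also have "\<dots> = T"
      using f(2) by (simp add: T_def bij_betw_def)
    finally have "(*v) A ` T = T" .
    moreover have "A *v x = y"
      using A(2)[of a] ab f(3) by (simp add: extreme_point_of_def)
    ultimately show ?thesis
      using A(1) by blast
  qed
  then obtain r where r: "0 < r" "T = cball 0 r"
    using ball_of_orthogonal_symmetries[OF T spT infT] by metis
  define V where "V x = (1 / r) *\<^sub>R x + 0" for x :: "real ^ 3"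
  have "affine_map_on T V"
    unfolding V_def by (rule affine_map_on_linear_add) simp
  then have "affine_map_on S (V \<circ> U)"
    using U_affine by (intro affine_map_on_comp) (auto simp: T_def)
  moreover have "bij_betw V T (cball 0 1)"
    using r by (intro bij_betw_byWitness[where f' = "\<lambda>x. r *\<^sub>R x"]) (auto simp: V_def field_simps)
  then have "bij_betw (V \<circ> U) S (cball 0 1)"
    using U_bij by (meson bij_betw_trans)
  ultimately show ?thesis
    unfolding affine_isomorphic_def by blast
qed

lemma affine_isomorphic_sym:
  assumes "convex S" "affine_isomorphic S T"
  shows "affine_isomorphic T S"
  using assms affine_map_on_inv_into bij_betw_inv_into unfolding affine_isomorphic_def by metis

lemma symmetric_spectral_affine_isomorphic:
  assumes "convex T" "affine_isomorphic T S"
    and "affine_automorphisms_transitive_on_extreme_points T" "has_spectrality T"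
  shows "affine_automorphisms_transitive_on_extreme_points S \<and> has_spectrality S"
  using assms transitive_on_extreme_points_affine_bij has_spectrality_affine_bij
  unfolding affine_isomorphic_def by metis

theorem theorem4:
  fixes S :: "(real ^ 3) set"
  assumes "compact S" and "convex S" and "affine hull S = UNIV"
  shows "((\<exists>T :: (real ^ 3) set. 3 simplex T \<and> affine_isomorphic S T) \<or>
           affine_isomorphic S (cball (0 :: real ^ 3) 1))
     \<longleftrightarrow> (affine_automorphisms_transitive_on_extreme_points S \<and> has_spectrality S)"
proof
  assume "(\<exists>T :: (real ^ 3) set. 3 simplex T \<and> affine_isomorphic S T) \<or>
    affine_isomorphic S (cball (0 :: real ^ 3) 1)"
  then show "affine_automorphisms_transitive_on_extreme_points S \<and> has_spectrality S"
  proof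
    assume "\<exists>T :: (real ^ 3) set. 3 simplex T \<and> affine_isomorphic S T"
    then obtain C :: "(real ^ 3) set" where "\<not> affine_dependent C" "affine_isomorphic S (convex hull C)"
      by (auto simp: simplex_def)
    then show ?thesis
      using transitive_on_extreme_points_simplex[of C] has_spectrality_simplex[of C]
      by (intro symmetric_spectral_affine_isomorphic[OF convex_convex_hull affine_isomorphic_sym[OF assms(2)]])
  next
    assume "affine_isomorphic S (cball (0 :: real ^ 3) 1)"
    then show ?thesis
      by (rule symmetric_spectral_affine_isomorphic[OF convex_cball affine_isomorphic_sym[OF assms(2)]
          transitive_on_extreme_points_unit_ball has_spectrality_unit_ball])
  qed
next
  assume R: "affine_automorphisms_transitive_on_extreme_points S \<and> has_spectrality S"
  show "(\<exists>T :: (real ^ 3) set. 3 simplex T \<and> affine_isomorphic S T) \<or>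
    affine_isomorphic S (cball (0 :: real ^ 3) 1)"
  proof (cases "3 simplex S")
    case True
    have "affine_map_on S id" "bij_betw id S S"
      by (simp_all add: affine_map_on_def)
    then show ?thesis
      using True unfolding affine_isomorphic_def by blast
  next
    case False
    then have "infinite {x. x extreme_point_of S}"
      using infinite_extreme_points[OF assms(2,3)] R by simp
    then show ?thesis
      using affine_isomorphic_unit_ball[OF assms] R by blast
  qed
qed

end
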